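(* Let $(H,\mathcal R)$ be a finite-dimensional factorisable quasitriangular Hopf algebra over a field $k$ and $\underline H$ its transmutation, a Hopf algebra in the braided category of $H$-modules. Then there is a Type 2 Hadamard form on $\underline H$, namely a morphism of $H$-modules $\theta:\underline H\otimes\underline H\to k$, inverse to the metric element $$\Theta=(S\otimes\mathrm{id})\mathcal Q\in\underline H\otimes\underline H,\qquad\mathcal Q=\mathcal R_{21}\mathcal R.$$ That is, writing $\Theta=\Theta^1\otimes\Theta^2$, one has $\theta(h,\Theta^1)\Theta^2=h=\Theta^1\theta(\Theta^2,h)$ for all $h\in\underline H$, and, writing $\underline\Delta h=h_{\underline1}\otimes h_{\underline2}$, for all $h,h',h''\in\underline H$, $$\theta(hh',h'')=\theta(h,h''_{\underline2})\,\theta(h',h''_{\underline1}),\qquad\theta(h,h'h'')=\theta(h_{\underline2},h')\,\theta(h_{\underline1},h''),\qquad\theta(1,h)=\epsilon(h)=\theta(h,1).$$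
   Context: Notation: $\Delta h=h_1\otimes h_2$, $\mathcal R=\mathcal R^1\otimes\mathcal R^2$, sums understood. $(H,\mathcal R)$ is factorisable if $\mathcal Q=\mathcal R_{21}\mathcal R$ is invertible when viewed as a linear map $H^*\to H$ by evaluation against its first factor. The category of $H$-modules is braided by $\Psi(v\otimes w)=\mathcal R^2\triangleright w\otimes\mathcal R^1\triangleright v$. The transmutation $\underline H$ has the same algebra and counit as $H$, is an object by the adjoint action $h\triangleright h'=h_1h'Sh_2$, and has coproduct and antipode $$\underline\Delta h=h_1S\mathcal R^2\otimes\mathcal R^1\triangleright h_2,\qquad\underline Sh=\mathcal R^2S(\mathcal R^1\triangleright h);$$ it is known to be a Hopf algebra in this braided category. A Type 2 Hadamard form on a braided Hopf algebra $B$ is a nondegenerate bilinear morphism $\theta:B\otimes B\to\underline1$ (nondegenerate meaning that there is an inverse morphism $\underline1\to B\otimes B$) for which the adjoint (with nested evaluations, no braid crossings) of the product is the coproduct on either side, i.e. the displayed identities hold. *)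

theory Defs
  imports Complex_Main
begin

text \<open>
  An element of a tensor product is written, as in Sweedler notation, as a finite formal sum of
  pure tensors: a list of pairs for \<open>V \<otimes> V\<close>, a list of triples for \<open>V \<otimes> V \<otimes> V\<close>. List append is
  addition. The tensor product is the quotient of these formal sums by the congruence generated
  by the usual relations (additivity in every slot, moving scalars between slots). Equality in
  the tensor product is always this congruence, never equality of lists.
  A multilinear map \<open>f\<close> is applied to \<open>t\<close> as \<open>\<Sum>(a, b)\<leftarrow>t. f a b\<close>, which depends only on the
  class of \<open>t\<close>.
\<close>

inductive formal_sum_eq :: "('p list \<Rightarrow> 'p list \<Rightarrow> bool) \<Rightarrow> 'p list \<Rightarrow> 'p list \<Rightarrow> bool"
  for rel where
  base: "rel t u \<Longrightarrow> formal_sum_eq rel t u"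
| refl: "formal_sum_eq rel t t"
| sym: "formal_sum_eq rel t u \<Longrightarrow> formal_sum_eq rel u t"
| trans: "formal_sum_eq rel t u \<Longrightarrow> formal_sum_eq rel u v \<Longrightarrow> formal_sum_eq rel t v"
| append: "formal_sum_eq rel t u \<Longrightarrow> formal_sum_eq rel t' u' \<Longrightarrow> formal_sum_eq rel (t @ t') (u @ u')"
| commute: "formal_sum_eq rel (t @ u) (u @ t)"

inductive tensor2_rel ::
  "('k \<Rightarrow> 'v::ab_group_add \<Rightarrow> 'v) \<Rightarrow> ('v \<times> 'v) list \<Rightarrow> ('v \<times> 'v) list \<Rightarrow> bool"
  for scale where
  add1: "tensor2_rel scale [(x + x', y)] [(x, y), (x', y)]"
| add2: "tensor2_rel scale [(x, y + y')] [(x, y), (x, y')]"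
| scalar: "tensor2_rel scale [(scale c x, y)] [(x, scale c y)]"
| zero1: "tensor2_rel scale [(0, y)] []"
| zero2: "tensor2_rel scale [(x, 0)] []"

inductive tensor3_rel ::
  "('k \<Rightarrow> 'v::ab_group_add \<Rightarrow> 'v) \<Rightarrow> ('v \<times> 'v \<times> 'v) list \<Rightarrow> ('v \<times> 'v \<times> 'v) list \<Rightarrow> bool"
  for scale where
  add1: "tensor3_rel scale [(x + x', y, z)] [(x, y, z), (x', y, z)]"
| add2: "tensor3_rel scale [(x, y + y', z)] [(x, y, z), (x, y', z)]"
| add3: "tensor3_rel scale [(x, y, z + z')] [(x, y, z), (x, y, z')]"
| scalar12: "tensor3_rel scale [(scale c x, y, z)] [(x, scale c y, z)]"
| scalar23: "tensor3_rel scale [(x, scale c y, z)] [(x, y, scale c z)]"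
| zero1: "tensor3_rel scale [(0, y, z)] []"
| zero2: "tensor3_rel scale [(x, 0, z)] []"
| zero3: "tensor3_rel scale [(x, y, 0)] []"

abbreviation tensor2_eq where
  "tensor2_eq scale \<equiv> formal_sum_eq (tensor2_rel scale)"

abbreviation tensor3_eq where
  "tensor3_eq scale \<equiv> formal_sum_eq (tensor3_rel scale)"

definition tensor2_scale :: "('k \<Rightarrow> 'v \<Rightarrow> 'v) \<Rightarrow> 'k \<Rightarrow> ('v \<times> 'v) list \<Rightarrow> ('v \<times> 'v) list" where
  "tensor2_scale scale c t = [(scale c a, b). (a, b) \<leftarrow> t]"

definition tensor2_flip :: "('v \<times> 'v) list \<Rightarrow> ('v \<times> 'v) list" where
  "tensor2_flip t = [(b, a). (a, b) \<leftarrow> t]"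

definition tensor2_mult :: "('h::times \<times> 'h) list \<Rightarrow> ('h \<times> 'h) list \<Rightarrow> ('h \<times> 'h) list" where
  "tensor2_mult t u = [(a * a', b * b'). (a, b) \<leftarrow> t, (a', b') \<leftarrow> u]"

definition tensor3_mult ::
  "('h::times \<times> 'h \<times> 'h) list \<Rightarrow> ('h \<times> 'h \<times> 'h) list \<Rightarrow> ('h \<times> 'h \<times> 'h) list" where
  "tensor3_mult t u = [(a * a', b * b', c * c'). (a, b, c) \<leftarrow> t, (a', b', c') \<leftarrow> u]"

definition leg12 :: "('h::one \<times> 'h) list \<Rightarrow> ('h \<times> 'h \<times> 'h) list" where
  "leg12 t = [(a, b, 1). (a, b) \<leftarrow> t]"

definition leg13 :: "('h::one \<times> 'h) list \<Rightarrow> ('h \<times> 'h \<times> 'h) list" where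
  "leg13 t = [(a, 1, b). (a, b) \<leftarrow> t]"

definition leg23 :: "('h::one \<times> 'h) list \<Rightarrow> ('h \<times> 'h \<times> 'h) list" where
  "leg23 t = [(1, a, b). (a, b) \<leftarrow> t]"

definition apply_left :: "('h \<Rightarrow> ('h \<times> 'h) list) \<Rightarrow> ('h \<times> 'h) list \<Rightarrow> ('h \<times> 'h \<times> 'h) list" where
  "apply_left \<Delta> t = [(a1, a2, b). (a, b) \<leftarrow> t, (a1, a2) \<leftarrow> \<Delta> a]"

definition apply_right :: "('h \<Rightarrow> ('h \<times> 'h) list) \<Rightarrow> ('h \<times> 'h) list \<Rightarrow> ('h \<times> 'h \<times> 'h) list" where
  "apply_right \<Delta> t = [(a, b1, b2). (a, b) \<leftarrow> t, (b1, b2) \<leftarrow> \<Delta> b]"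

locale fd_algebra = vector_space scale
  for scale :: "'k::field \<Rightarrow> 'h::ring_1 \<Rightarrow> 'h" +
  assumes finite_dim: "\<exists>B. finite B \<and> span B = UNIV"
    and scale_mult_left: "scale c x * y = scale c (x * y)"
    and scale_mult_right: "x * scale c y = scale c (x * y)"

text \<open>\<open>\<Delta> h\<close> is a chosen formal sum representing the coproduct of \<open>h\<close>.\<close>

locale fd_hopf_algebra = fd_algebra scale
  for scale :: "'k::field \<Rightarrow> 'h::ring_1 \<Rightarrow> 'h" +
  fixes \<Delta> :: "'h \<Rightarrow> ('h \<times> 'h) list"
    and \<epsilon> :: "'h \<Rightarrow> 'k"
    and S :: "'h \<Rightarrow> 'h"
  assumes coproduct_add: "tensor2_eq scale (\<Delta> (x + y)) (\<Delta> x @ \<Delta> y)"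
    and coproduct_scale: "tensor2_eq scale (\<Delta> (scale c x)) (tensor2_scale scale c (\<Delta> x))"
    and coproduct_mult: "tensor2_eq scale (\<Delta> (x * y)) (tensor2_mult (\<Delta> x) (\<Delta> y))"
    and coproduct_one: "tensor2_eq scale (\<Delta> 1) [(1, 1)]"
    and counit_linear: "Vector_Spaces.linear scale (*) \<epsilon>"
    and counit_mult: "\<epsilon> (x * y) = \<epsilon> x * \<epsilon> y"
    and counit_one: "\<epsilon> 1 = 1"
    and antipode_linear: "Vector_Spaces.linear scale scale S"
    and coassoc: "tensor3_eq scale (apply_left \<Delta> (\<Delta> x)) (apply_right \<Delta> (\<Delta> x))"
    and counit_left: "(\<Sum>(a, b)\<leftarrow>\<Delta> x. scale (\<epsilon> a) b) = x"
    and counit_right: "(\<Sum>(a, b)\<leftarrow>\<Delta> x. scale (\<epsilon> b) a) = x"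
    and antipode_left: "(\<Sum>(a, b)\<leftarrow>\<Delta> x. S a * b) = scale (\<epsilon> x) 1"
    and antipode_right: "(\<Sum>(a, b)\<leftarrow>\<Delta> x. a * S b) = scale (\<epsilon> x) 1"

locale fd_quasitriangular_hopf_algebra = fd_hopf_algebra scale \<Delta> \<epsilon> S
  for scale :: "'k::field \<Rightarrow> 'h::ring_1 \<Rightarrow> 'h" and \<Delta> \<epsilon> S +
  fixes R :: "('h \<times> 'h) list"
  assumes R_invertible: "\<exists>R'. tensor2_eq scale (tensor2_mult R R') [(1, 1)]
      \<and> tensor2_eq scale (tensor2_mult R' R) [(1, 1)]"
    and R_intertwines:
      "tensor2_eq scale (tensor2_mult (tensor2_flip (\<Delta> x)) R) (tensor2_mult R (\<Delta> x))"
    and R_hexagon1: "tensor3_eq scale (apply_left \<Delta> R) (tensor3_mult (leg13 R) (leg23 R))"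
    and R_hexagon2: "tensor3_eq scale (apply_right \<Delta> R) (tensor3_mult (leg13 R) (leg12 R))"

definition Q_element :: "('h::times \<times> 'h) list \<Rightarrow> ('h \<times> 'h) list" where
  "Q_element R = tensor2_mult (tensor2_flip R) R"

locale fd_factorisable_hopf_algebra = fd_quasitriangular_hopf_algebra scale \<Delta> \<epsilon> S R
  for scale :: "'k::field \<Rightarrow> 'h::ring_1 \<Rightarrow> 'h" and \<Delta> \<epsilon> S R +
  assumes factorisable: "bij_betw (\<lambda>f. \<Sum>(a, b)\<leftarrow>Q_element R. scale (f a) b)
      {f. Vector_Spaces.linear scale (*) f} UNIV"

text \<open>
  The data of a Hopf algebra \<open>B\<close> in the category of left \<open>H\<close>-modules; as for \<open>H\<close>, the coproduct
  is given by representing formal sums.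
\<close>

record ('k, 'h, 'b) braided_hopf =
  bscale :: "'k \<Rightarrow> 'b \<Rightarrow> 'b"
  baction :: "'h \<Rightarrow> 'b \<Rightarrow> 'b"
  bmult :: "'b \<Rightarrow> 'b \<Rightarrow> 'b"
  bunit :: 'b
  bcoproduct :: "'b \<Rightarrow> ('b \<times> 'b) list"
  bcounit :: "'b \<Rightarrow> 'k"
  bantipode :: "'b \<Rightarrow> 'b"

definition adjoint_action ::
  "('h::ring_1 \<Rightarrow> ('h \<times> 'h) list) \<Rightarrow> ('h \<Rightarrow> 'h) \<Rightarrow> 'h \<Rightarrow> 'h \<Rightarrow> 'h" where
  "adjoint_action \<Delta> S h x = (\<Sum>(h1, h2)\<leftarrow>\<Delta> h. h1 * x * S h2)"

definition transmutation ::
  "('k::field \<Rightarrow> 'h::ring_1 \<Rightarrow> 'h) \<Rightarrow> ('h \<Rightarrow> ('h \<times> 'h) list) \<Rightarrow> ('h \<Rightarrow> 'k) \<Rightarrow> ('h \<Rightarrow> 'h)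
    \<Rightarrow> ('h \<times> 'h) list \<Rightarrow> ('k, 'h, 'h) braided_hopf" where
  "transmutation scale \<Delta> \<epsilon> S R =
    \<lparr> bscale = scale,
      baction = adjoint_action \<Delta> S,
      bmult = (*),
      bunit = 1,
      bcoproduct = (\<lambda>h. [(h1 * S r2, adjoint_action \<Delta> S r1 h2). (h1, h2) \<leftarrow> \<Delta> h, (r1, r2) \<leftarrow> R]),
      bcounit = \<epsilon>,
      bantipode = (\<lambda>h. \<Sum>(r1, r2)\<leftarrow>R. r2 * S (adjoint_action \<Delta> S r1 h)) \<rparr>"

definition bilinear_form :: "('k::field \<Rightarrow> 'b::ab_group_add \<Rightarrow> 'b) \<Rightarrow> ('b \<Rightarrow> 'b \<Rightarrow> 'k) \<Rightarrow> bool" where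
  "bilinear_form scale \<theta> \<longleftrightarrow>
    (\<forall>y. Vector_Spaces.linear scale (*) (\<lambda>x. \<theta> x y)) \<and>
    (\<forall>x. Vector_Spaces.linear scale (*) (\<theta> x))"

text \<open>
  In the following, \<open>\<Delta>\<close> and \<open>\<epsilon>\<close> belong to \<open>H\<close>; they give the \<open>H\<close>-module structures of
  \<open>B \<otimes> B\<close> and of the unit object \<open>k\<close>. Morphisms \<open>k \<rightarrow> B \<otimes> B\<close> are identified with the image
  of \<open>1\<close>.
\<close>

definition form_morphism ::
  "('h \<Rightarrow> ('h \<times> 'h) list) \<Rightarrow> ('h \<Rightarrow> 'k) \<Rightarrow> ('k::field, 'h, 'b::ab_group_add) braided_hopf
    \<Rightarrow> ('b \<Rightarrow> 'b \<Rightarrow> 'k) \<Rightarrow> bool" where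
  "form_morphism \<Delta> \<epsilon> B \<theta> \<longleftrightarrow> bilinear_form (bscale B) \<theta> \<and>
    (\<forall>h x y. (\<Sum>(h1, h2)\<leftarrow>\<Delta> h. \<theta> (baction B h1 x) (baction B h2 y)) = \<epsilon> h * \<theta> x y)"

definition metric_morphism ::
  "('h \<Rightarrow> ('h \<times> 'h) list) \<Rightarrow> ('h \<Rightarrow> 'k) \<Rightarrow> ('k::field, 'h, 'b::ab_group_add) braided_hopf
    \<Rightarrow> ('b \<times> 'b) list \<Rightarrow> bool" where
  "metric_morphism \<Delta> \<epsilon> B T \<longleftrightarrow>
    (\<forall>h. tensor2_eq (bscale B)
      [(baction B h1 a, baction B h2 b). (h1, h2) \<leftarrow> \<Delta> h, (a, b) \<leftarrow> T]
      (tensor2_scale (bscale B) (\<epsilon> h) T))"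

definition inverse_metric ::
  "('h \<Rightarrow> ('h \<times> 'h) list) \<Rightarrow> ('h \<Rightarrow> 'k) \<Rightarrow> ('k::field, 'h, 'b::ab_group_add) braided_hopf
    \<Rightarrow> ('b \<Rightarrow> 'b \<Rightarrow> 'k) \<Rightarrow> ('b \<times> 'b) list \<Rightarrow> bool" where
  "inverse_metric \<Delta> \<epsilon> B \<theta> T \<longleftrightarrow> metric_morphism \<Delta> \<epsilon> B T \<and>
    (\<forall>x. (\<Sum>(a, b)\<leftarrow>T. bscale B (\<theta> x a) b) = x) \<and>
    (\<forall>x. (\<Sum>(a, b)\<leftarrow>T. bscale B (\<theta> b x) a) = x)"

definition type2_hadamard_form ::
  "('h \<Rightarrow> ('h \<times> 'h) list) \<Rightarrow> ('h \<Rightarrow> 'k) \<Rightarrow> ('k::field, 'h, 'b::ab_group_add) braided_hopf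
    \<Rightarrow> ('b \<Rightarrow> 'b \<Rightarrow> 'k) \<Rightarrow> bool" where
  "type2_hadamard_form \<Delta> \<epsilon> B \<theta> \<longleftrightarrow>
    form_morphism \<Delta> \<epsilon> B \<theta> \<and>
    (\<exists>T. inverse_metric \<Delta> \<epsilon> B \<theta> T) \<and>
    (\<forall>x y z. \<theta> (bmult B x y) z = (\<Sum>(z1, z2)\<leftarrow>bcoproduct B z. \<theta> x z2 * \<theta> y z1)) \<and>
    (\<forall>x y z. \<theta> x (bmult B y z) = (\<Sum>(x1, x2)\<leftarrow>bcoproduct B x. \<theta> x2 y * \<theta> x1 z)) \<and>
    (\<forall>x. \<theta> (bunit B) x = bcounit B x) \<and>
    (\<forall>x. \<theta> x (bunit B) = bcounit B x)"

definition metric_element :: "('h \<Rightarrow> 'h) \<Rightarrow> ('h::times \<times> 'h) list \<Rightarrow> ('h \<times> 'h) list" where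
  "metric_element S R = [(S a, b). (a, b) \<leftarrow> Q_element R]"

end

theory Submission
  imports Defs
begin

text \<open>
  Since the antipode is bijective and \<open>Q\<close> is nondegenerate, so is \<open>\<Theta>\<close>; let \<open>\<theta>\<close> be its
  inverse. Every property of \<open>\<theta>\<close> is dual to a property of \<open>\<Theta>\<close>. Invariance comes from
  \<open>Q \<Delta>(h) = \<Delta>(h) Q\<close>. The two Hadamard identities come from
  \<open>Q\<^sup>1 \<otimes> \<Delta>' Q\<^sup>2 = Q'\<^sup>1 Q\<^sup>1 \<otimes> Q'\<^sup>2 \<otimes> Q\<^sup>2\<close>,
  where \<open>\<Delta>'\<close> is the braided coproduct and \<open>Q'\<close> a second copy of \<open>Q\<close>, together with
  \<open>(S \<otimes> S) Q = Q\<^sub>2\<^sub>1\<close>. That last identity also gives surjectivity of \<open>S\<close>: a functional \<open>f\<close>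
  with \<open>f \<circ> S = 0\<close> kills \<open>g(Q\<^sup>1) Q\<^sup>2\<close> for every functional \<open>g\<close>, hence everything.

  Tensor identities are verified by applying multilinear functionals to both sides, which is
  faithful because a tensor has a normal form with respect to a basis.
\<close>

section \<open>Tensors tested by multilinear functionals\<close>

text \<open>\<open>F\<close> is curried so that nested sums read as Sweedler notation with named
  legs. Identities of tensors become equations between iterated sums, which can be swapped and
  rewritten.\<close>

definition tsum :: "('a \<times> 'b) list \<Rightarrow> ('a \<Rightarrow> 'b \<Rightarrow> 'c::comm_monoid_add) \<Rightarrow> 'c" where
  "tsum t F = (\<Sum>(a, b)\<leftarrow>t. F a b)"

definition tsum3 :: "('a \<times> 'b \<times> 'c) list \<Rightarrow> ('a \<Rightarrow> 'b \<Rightarrow> 'c \<Rightarrow> 'd::comm_monoid_add) \<Rightarrow> 'd" where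
  "tsum3 t F = (\<Sum>(a, b, c)\<leftarrow>t. F a b c)"

lemma tsum_simps [simp]:
  "tsum [] F = 0" "tsum (p # t) F = F (fst p) (snd p) + tsum t F"
  "tsum (t @ u) F = tsum t F + tsum u F"
  by (auto simp: tsum_def split: prod.splits)

lemma tsum3_simps [simp]:
  "tsum3 [] F = 0" "tsum3 (p # t) F = F (fst p) (fst (snd p)) (snd (snd p)) + tsum3 t F"
  "tsum3 (t @ u) F = tsum3 t F + tsum3 u F"
  by (auto simp: tsum3_def split: prod.splits)

lemma tsum_cong: "(\<And>a b. F a b = G a b) \<Longrightarrow> tsum t F = tsum t G"
  by (simp add: tsum_def)

lemma tsum_zero [simp]: "tsum t (\<lambda>a b. 0) = 0"
  by (induction t) auto

lemma tsum_add: "tsum t (\<lambda>a b. F a b + G a b) = tsum t F + tsum t G"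
  by (induction t) (auto simp: ac_simps)

lemma tsum_distrib_left: "c * tsum t F = tsum t (\<lambda>a b. c * F a b :: 'a::semiring_0)"
  by (induction t) (auto simp: algebra_simps)

lemma tsum_distrib_right: "tsum t F * c = tsum t (\<lambda>a b. F a b * c :: 'a::semiring_0)"
  by (induction t) (auto simp: algebra_simps)

lemma tsum_swap:
  "tsum t (\<lambda>a b. tsum u (\<lambda>c d. F a b c d)) = tsum u (\<lambda>c d. tsum t (\<lambda>a b. F a b c d))"
  by (induction t) (simp_all add: tsum_add)

lemma tsum_rotate:
  "tsum t (\<lambda>a b. tsum u (\<lambda>c d. tsum v (\<lambda>e f. F a b c d e f))) =
    tsum v (\<lambda>e f. tsum t (\<lambda>a b. tsum u (\<lambda>c d. F a b c d e f)))"
  by (simp only: tsum_swap[of u v] tsum_swap[of t v])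

lemma tsum_map: "tsum (map f t) F = (\<Sum>p\<leftarrow>t. F (fst (f p)) (snd (f p)))"
  by (induction t) auto

lemma tsum_concat_map: "tsum (concat (map f t)) F = (\<Sum>p\<leftarrow>t. tsum (f p) F)"
  by (induction t) auto

lemma tsum3_map:
  "tsum3 (map f t) F = (\<Sum>p\<leftarrow>t. F (fst (f p)) (fst (snd (f p))) (snd (snd (f p))))"
  by (induction t) auto

lemma tsum3_concat_map: "tsum3 (concat (map f t)) F = (\<Sum>p\<leftarrow>t. tsum3 (f p) F)"
  by (induction t) auto

lemma tsum_flip: "tsum (tensor2_flip t) F = tsum t (\<lambda>a b. F b a)"
  by (simp add: tensor2_flip_def tsum_map) (simp add: tsum_def case_prod_unfold)

lemma tsum_mult:
  "tsum (tensor2_mult t u) F = tsum t (\<lambda>a b. tsum u (\<lambda>c d. F (a * c) (b * d)))"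
  by (simp add: tensor2_mult_def tsum_concat_map tsum_map case_prod_unfold)
    (simp add: tsum_def case_prod_unfold)

lemma tsum3_mult:
  "tsum3 (tensor3_mult t u) F =
    tsum3 t (\<lambda>a b c. tsum3 u (\<lambda>a' b' c'. F (a * a') (b * b') (c * c')))"
  by (simp add: tensor3_mult_def tsum3_concat_map tsum3_map case_prod_unfold)
    (simp add: tsum3_def case_prod_unfold)

lemma tsum3_leg:
  "tsum3 (leg12 t) F = tsum t (\<lambda>a b. F a b 1)"
  "tsum3 (leg13 t) F = tsum t (\<lambda>a b. F a 1 b)"
  "tsum3 (leg23 t) F = tsum t (\<lambda>a b. F 1 a b)"
  by (simp_all add: leg12_def leg13_def leg23_def tsum3_map case_prod_unfold)
    (simp_all add: tsum_def case_prod_unfold)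

lemma tsum3_apply:
  "tsum3 (apply_left \<Delta> t) F = tsum t (\<lambda>a b. tsum (\<Delta> a) (\<lambda>a1 a2. F a1 a2 b))"
  "tsum3 (apply_right \<Delta> t) F = tsum t (\<lambda>a b. tsum (\<Delta> b) (\<lambda>b1 b2. F a b1 b2))"
  by (simp_all add: apply_left_def apply_right_def tsum3_concat_map tsum3_map case_prod_unfold)
    (simp_all add: tsum_def case_prod_unfold)

section \<open>Linear, bilinear and trilinear functionals\<close>

context fd_algebra
begin

definition functional :: "('h \<Rightarrow> 'k) \<Rightarrow> bool" where
  "functional f \<longleftrightarrow> Vector_Spaces.linear scale (*) f"

definition endo :: "('h \<Rightarrow> 'h) \<Rightarrow> bool" where
  "endo g \<longleftrightarrow> Vector_Spaces.linear scale scale g"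

definition bilin :: "('h \<Rightarrow> 'h \<Rightarrow> 'k) \<Rightarrow> bool" where
  "bilin F \<longleftrightarrow> (\<forall>b. functional (\<lambda>a. F a b)) \<and> (\<forall>a. functional (\<lambda>b. F a b))"

definition trilin :: "('h \<Rightarrow> 'h \<Rightarrow> 'h \<Rightarrow> 'k) \<Rightarrow> bool" where
  "trilin F \<longleftrightarrow> (\<forall>b c. functional (\<lambda>a. F a b c)) \<and> (\<forall>a c. functional (\<lambda>b. F a b c)) \<and>
    (\<forall>a b. functional (\<lambda>c. F a b c))"

lemma functional_iff:
  "functional f \<longleftrightarrow> (\<forall>x y. f (x + y) = f x + f y) \<and> (\<forall>c x. f (scale c x) = c * f x)"
proof -
  have "vector_space ((*) :: 'k \<Rightarrow> 'k \<Rightarrow> 'k)"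
    by unfold_locales (simp_all add: algebra_simps)
  then show ?thesis
    by (auto simp: functional_def Vector_Spaces.linear_iff vector_space_axioms)
qed

lemma endo_iff:
  "endo f \<longleftrightarrow> (\<forall>x y. f (x + y) = f x + f y) \<and> (\<forall>c x. f (scale c x) = scale c (f x))"
  by (auto simp: endo_def Vector_Spaces.linear_iff vector_space_axioms)

lemma functionalI:
  "(\<And>x y. f (x + y) = f x + f y) \<Longrightarrow> (\<And>c x. f (scale c x) = c * f x) \<Longrightarrow> functional f"
  by (simp add: functional_iff)

lemma functionalD:
  assumes "functional f"
  shows "f (x + y) = f x + f y" "f (scale c x) = c * f x" "f 0 = 0"
proof -
  show *: "f (x + y) = f x + f y" "f (scale c x) = c * f x" for x y c
    using assms by (auto simp: functional_iff)
  show "f 0 = 0" using *(2)[of 0 0] by simp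
qed

lemma bilinI:
  "(\<And>b. functional (\<lambda>a. F a b)) \<Longrightarrow> (\<And>a. functional (\<lambda>b. F a b)) \<Longrightarrow> bilin F"
  by (simp add: bilin_def)

lemma trilinI:
  "(\<And>b c. functional (\<lambda>a. F a b c)) \<Longrightarrow> (\<And>a c. functional (\<lambda>b. F a b c)) \<Longrightarrow>
    (\<And>a b. functional (\<lambda>c. F a b c)) \<Longrightarrow> trilin F"
  by (simp add: trilin_def)

lemma functional_comp: "functional f \<Longrightarrow> endo g \<Longrightarrow> functional (\<lambda>x. f (g x))"
  by (simp add: functional_iff endo_iff)

lemma bilin_comp:
  assumes "bilin F" "endo g"
  shows "functional (\<lambda>x. F (g x) b)" "functional (\<lambda>x. F a (g x))"
  using assms functional_comp[of "\<lambda>x. F x b" g] functional_comp[of "F a" g]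
  by (simp_all add: bilin_def)

lemma trilin_comp:
  assumes "trilin F" "endo g"
  shows "functional (\<lambda>x. F (g x) b c)" "functional (\<lambda>x. F a (g x) c)"
    "functional (\<lambda>x. F a b (g x))"
  using assms functional_comp[of "\<lambda>x. F x b c" g] functional_comp[of "\<lambda>x. F a x c" g]
    functional_comp[of "F a b" g]
  by (simp_all add: trilin_def)

lemma endo_id: "endo (\<lambda>x. x)"
  by (simp add: endo_iff)

lemma functional_mult:
  "functional f \<Longrightarrow> functional (\<lambda>x. c * f x)" "functional f \<Longrightarrow> functional (\<lambda>x. f x * c)"
  by (simp_all add: functional_iff algebra_simps)

lemma functional_tsum:
  "(\<And>a b. functional (\<lambda>x. F x a b)) \<Longrightarrow> functional (\<lambda>x. tsum t (\<lambda>a b. F x a b))"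
  by (induction t) (simp_all add: functional_iff algebra_simps)

lemma functional_apply_tsum:
  "functional f \<Longrightarrow> f (tsum t F) = tsum t (\<lambda>a b. f (F a b))"
  by (induction t) (simp_all add: functionalD)

text \<open>Only the generating relations need bilinearity; the closure rules of the congruence
  respect sums of any function.\<close>

lemma tensor2_eq_tsum:
  assumes "tensor2_eq scale t u" "bilin F"
  shows "tsum t F = tsum u F"
  using assms(1)
proof induction
  case (base t u)
  note F = functionalD[of "\<lambda>x. F x b" for b] functionalD[of "F a" for a]
  from base show ?case
    using assms(2) by cases (auto simp: bilin_def F)
qed (auto simp: ac_simps)

lemma tensor3_eq_tsum3:
  assumes "tensor3_eq scale t u" "trilin F"
  shows "tsum3 t F = tsum3 u F"
  using assms(1)
proof induction
  case (base t u)
  note F = functionalD[of "\<lambda>x. F x b c" for b c] functionalD[of "\<lambda>x. F a x c" for a c]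
    functionalD[of "F a b" for a b]
  from base show ?case
    using assms(2) by cases (auto simp: trilin_def F)
qed (auto simp: ac_simps)

lemma tsum_scale_right: "scale c (tsum t F) = tsum t (\<lambda>a b. scale c (F a b))"
  by (induction t) (simp_all add: scale_right_distrib)

lemma tsum_tensor2_scale:
  assumes "bilin F"
  shows "tsum (tensor2_scale scale c t) F = c * tsum t F"
proof -
  have "F (scale c a) b = c * F a b" for a b
    using assms functionalD(2)[of "\<lambda>x. F x b"] by (simp add: bilin_def)
  then show ?thesis
    by (induction t) (auto simp: tensor2_scale_def algebra_simps)
qed

section \<open>Functionals separate vectors and tensors\<close>

lemma functional_representation:
  assumes "independent B" "span B = UNIV"
  shows "functional (\<lambda>v. representation B v b)"
  using assms by (intro functionalI) (simp_all add: representation_add representation_scale)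

text \<open>Extend a basis \<open>C\<close> of \<open>V\<close> to a basis \<open>B\<close> of the
  whole space. The coordinate along a vector of \<open>B\<close> outside \<open>C\<close> vanishes
  on \<open>V\<close>, because expansions of elements of \<open>V\<close> involve \<open>C\<close>
  only.\<close>

lemma functionals_separate_subspace:
  assumes "subspace V" "V \<noteq> UNIV"
  shows "\<exists>f. functional f \<and> (\<forall>x\<in>V. f x = 0) \<and> (\<exists>x. f x \<noteq> 0)"
proof -
  obtain C where C: "C \<subseteq> V" "independent C" "V \<subseteq> span C"
    by (rule maximal_independent_subset)
  have spanC: "span C = V"
    using C assms(1) by (simp add: span_minimal subset_antisym)
  obtain B where B: "C \<subseteq> B" "independent B" "UNIV \<subseteq> span B"
    by (rule maximal_independent_subset_extend[OF subset_UNIV C(2)])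
  have "B \<noteq> C"
    using B(3) assms(2) spanC by auto
  then obtain b where b: "b \<in> B" "b \<notin> C"
    using B(1) by auto
  show ?thesis
  proof (intro exI[of _ "\<lambda>v. representation B v b"] conjI ballI)
    show "functional (\<lambda>v. representation B v b)"
      using B by (intro functional_representation) auto
    show "representation B x b = 0" if "x \<in> V" for x
      using that B C b representation_extend[of B x C] representation_ne_zero[of C x b] spanC
      by auto
    show "\<exists>x. representation B x b \<noteq> 0"
      using representation_basis[OF B(2) b(1)] by (intro exI[of _ b]) simp
  qed
qed

lemma functional_ext:
  assumes "\<And>f. functional f \<Longrightarrow> f x = f y"
  shows "x = y"
proof (rule ccontr)
  assume "x \<noteq> y"
  obtain B where B: "independent B" "span B = UNIV"
    using maximal_independent_subset[of UNIV] by (metis top.extremum_uniqueI)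
  have "representation B x = representation B y"
    by (rule ext, rule assms, rule functional_representation[OF B])
  moreover have "(\<Sum>b | representation B z b \<noteq> 0. scale (representation B z b) b) = z" for z
    using B by (intro sum_nonzero_representation_eq) auto
  ultimately show False
    using \<open>x \<noteq> y\<close> by metis
qed

lemma tensor2_eq_add:
  "tensor2_eq scale (map (\<lambda>b. (b, f b)) bs @ map (\<lambda>b. (b, g b)) bs) (map (\<lambda>b. (b, f b + g b)) bs)"
proof (induction bs)
  case Nil
  show ?case by (simp add: formal_sum_eq.refl)
next
  case (Cons b bs)
  let ?f = "map (\<lambda>b. (b, f b)) bs" and ?g = "map (\<lambda>b. (b, g b)) bs"
  \<comment> \<open>The congruence only swaps two adjacent blocks, so \<open>(b, g b)\<close> is
    first moved past \<open>?f\<close> to stand next to \<open>(b, f b)\<close>.\<close>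
  have "tensor2_eq scale ([(b, f b)] @ (?f @ [(b, g b)]) @ ?g) ([(b, f b)] @ ([(b, g b)] @ ?f) @ ?g)"
    by (intro formal_sum_eq.append formal_sum_eq.commute formal_sum_eq.refl)
  moreover have "tensor2_eq scale ([(b, f b), (b, g b)] @ (?f @ ?g))
      ([(b, f b + g b)] @ map (\<lambda>b. (b, f b + g b)) bs)"
    by (rule formal_sum_eq.append[OF formal_sum_eq.sym Cons.IH])
      (rule formal_sum_eq.base, rule tensor2_rel.add2)
  ultimately show ?case
    using formal_sum_eq.trans by simp
qed

lemma tensor2_eq_sum_list:
  "tensor2_eq scale [(sum_list xs, y)] (map (\<lambda>x. (x, y)) xs)"
proof (induction xs)
  case Nil
  show ?case by (simp add: formal_sum_eq.base tensor2_rel.zero1)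
next
  case (Cons x xs)
  have "tensor2_eq scale [(x + sum_list xs, y)] ([(x, y)] @ [(sum_list xs, y)])"
    by (simp add: formal_sum_eq.base tensor2_rel.add1)
  moreover have "tensor2_eq scale ([(x, y)] @ [(sum_list xs, y)]) ([(x, y)] @ map (\<lambda>x. (x, y)) xs)"
    by (intro formal_sum_eq.append Cons.IH formal_sum_eq.refl)
  ultimately show ?case
    using formal_sum_eq.trans by simp
qed

lemma tensor2_eq_zero: "tensor2_eq scale (map (\<lambda>b. (b, 0)) bs) []"
proof (induction bs)
  case (Cons b bs)
  have "tensor2_eq scale [(b, 0)] []"
    by (simp add: formal_sum_eq.base tensor2_rel.zero2)
  from formal_sum_eq.append[OF this Cons] show ?case
    by simp
qed (simp add: formal_sum_eq.refl)

lemma tensor2_eq_scale: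
  "tensor2_eq scale (map (\<lambda>b. (scale (c b) b, y)) bs) (map (\<lambda>b. (b, scale (c b) y)) bs)"
proof (induction bs)
  case (Cons b bs)
  have "tensor2_eq scale [(scale (c b) b, y)] [(b, scale (c b) y)]"
    by (simp add: formal_sum_eq.base tensor2_rel.scalar)
  from formal_sum_eq.append[OF this Cons] show ?case
    by simp
qed (simp add: formal_sum_eq.refl)

text \<open>Expand every left factor in the basis, move the coordinates to the right and collect.
  What remains of a tensor is one vector per basis element, and functionals can detect these
  vectors.\<close>

lemma tensor2_eq_normal_form:
  assumes "independent (set bs)" "span (set bs) = UNIV" "distinct bs"
  shows "tensor2_eq scale t
    (map (\<lambda>b. (b, tsum t (\<lambda>x y. scale (representation (set bs) x b) y))) bs)"
proof (induction t)
  case Nil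
  show ?case
    by (simp add: formal_sum_eq.sym[OF tensor2_eq_zero])
next
  case (Cons p t)
  obtain x y where p: "p = (x, y)" by (cases p)
  let ?r = "representation (set bs)"
  have "x = (\<Sum>b\<in>set bs. scale (?r x b) b)"
    by (rule sum_representation_eq[symmetric]) (use assms in auto)
  also have "\<dots> = sum_list (map (\<lambda>b. scale (?r x b) b) bs)"
    using assms(3) by (simp add: sum_list_distinct_conv_sum_set)
  finally have "tensor2_eq scale [(x, y)] (map (\<lambda>b. (scale (?r x b) b, y)) bs)"
    using tensor2_eq_sum_list[of "map (\<lambda>b. scale (?r x b) b) bs" y] by (simp add: comp_def)
  then have "tensor2_eq scale [(x, y)] (map (\<lambda>b. (b, scale (?r x b) y)) bs)"
    using tensor2_eq_scale by (rule formal_sum_eq.trans)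
  from formal_sum_eq.trans[OF formal_sum_eq.append[OF this Cons.IH] tensor2_eq_add] show ?case
    by (simp add: p)
qed

lemma exists_finite_basis:
  obtains B where "finite B" "independent B" "span B = UNIV"
proof -
  obtain B where B: "independent B" "span B = UNIV"
    using maximal_independent_subset[of UNIV] by (metis top.extremum_uniqueI)
  obtain T where "finite T" "span T = UNIV"
    using finite_dim by auto
  then have "finite B"
    using independent_span_bound[of T B] B by simp
  then show thesis
    using that B by simp
qed

text \<open>The converse of \<open>tensor2_eq_tsum\<close>. Coordinate functionals times arbitrary
  functionals are bilinear, so agreement on them forces equal normal forms. It serves the one goal
  that is a congruence of tensors: that \<Theta> is a morphism.\<close>

lemma tensor2_eqI:
  assumes "\<And>F. bilin F \<Longrightarrow> tsum t F = tsum u F"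
  shows "tensor2_eq scale t u"
proof -
  obtain B where B: "finite B" "independent B" "span B = UNIV"
    by (rule exists_finite_basis)
  obtain bs where bs: "set bs = B" "distinct bs"
    using finite_distinct_list[OF B(1)] by blast
  have "tsum t (\<lambda>x y. scale (representation B x b) y) = tsum u (\<lambda>x y. scale (representation B x b) y)"
    for b
  proof (rule functional_ext)
    fix f assume f: "functional f"
    have "bilin (\<lambda>x y. representation B x b * f y)"
      using f B by (intro bilinI functional_mult functional_representation)
    from assms[OF this]
    show "f (tsum t (\<lambda>x y. scale (representation B x b) y)) =
        f (tsum u (\<lambda>x y. scale (representation B x b) y))"
      by (simp add: functional_apply_tsum[OF f] functionalD[OF f])
  qed
  then show ?thesis
    using tensor2_eq_normal_form[of bs t] tensor2_eq_normal_form[of bs u, THEN formal_sum_eq.sym] B bs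
    by (simp add: formal_sum_eq.trans)
qed

lemma endo_mult:
  "endo g \<Longrightarrow> endo (\<lambda>x. a * g x)" "endo g \<Longrightarrow> endo (\<lambda>x. g x * a)"
  by (simp_all add: endo_iff algebra_simps scale_mult_left scale_mult_right)

lemma endo_surj_imp_inj:
  assumes "endo f" "surj f"
  shows "inj f"
proof -
  obtain B where B: "finite B" "independent B" "span B = UNIV"
    by (rule exists_finite_basis)
  interpret V: finite_dimensional_vector_space_pair scale B scale B
    by unfold_locales (use B in auto)
  show ?thesis
    using assms by (simp add: endo_def V.linear_surjective_imp_injective)
qed

end

section \<open>Antipode and adjoint action\<close>

context fd_hopf_algebra
begin

text \<open>\<open>\<Delta>\<close> is linear only up to congruence, a difference that a bilinear
  form cannot see. The map \<open>g\<close> lets the rule match \<open>\<Delta>\<close> applied to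
  any linear expression.\<close>

lemma functional_tsum_coproduct:
  assumes "bilin F" "endo g"
  shows "functional (\<lambda>x. tsum (\<Delta> (g x)) F)"
proof (rule functionalI)
  show "tsum (\<Delta> (g (x + y))) F = tsum (\<Delta> (g x)) F + tsum (\<Delta> (g y)) F" for x y
    using tensor2_eq_tsum[OF coproduct_add assms(1)] assms(2) by (simp add: endo_iff)
  show "tsum (\<Delta> (g (scale c x))) F = c * tsum (\<Delta> (g x)) F" for c x
    using tensor2_eq_tsum[OF coproduct_scale assms(1)] assms(2)
    by (simp add: endo_iff tsum_tensor2_scale[OF assms(1)])
qed

lemma functional_counit: "endo g \<Longrightarrow> functional (\<lambda>x. \<epsilon> (g x))"
  by (rule functional_comp) (simp add: functional_def counit_linear)

lemma endo_antipode: "endo g \<Longrightarrow> endo (\<lambda>x. S (g x))"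
  using antipode_linear unfolding endo_def[symmetric] by (simp add: endo_iff)

text \<open>These rules prove multilinearity by recursion on the shape of an expression. Later
  proofs extend them, under the name \<open>lin\<close>, by rules for the functional at
  hand.\<close>

lemmas multilinear_intros = bilinI trilinI endo_id endo_mult endo_antipode functional_counit
  functional_mult functional_tsum functional_tsum_coproduct

lemma coassoc_tsum:
  assumes "trilin F"
  shows "tsum (\<Delta> x) (\<lambda>y c. tsum (\<Delta> y) (\<lambda>a b. F a b c)) =
    tsum (\<Delta> x) (\<lambda>a y. tsum (\<Delta> y) (\<lambda>b c. F a b c))"
  using tensor3_eq_tsum3[OF coassoc assms] by (simp add: tsum3_apply)

text \<open>Two bracketings of the fourfold coproduct. The second one puts the inner legs
  \<open>q\<close> and \<open>r\<close> under a coproduct of their own, so that \<open>Q\<close> can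
  be commuted past them in \<open>metric_invariant_tsum\<close>.\<close>

lemma coassoc4_tsum:
  assumes "trilin (\<lambda>p q y. tsum (\<Delta> y) (\<lambda>r s. M p q r s))" "\<And>p. trilin (\<lambda>q r s. M p q r s)"
  shows "tsum (\<Delta> h) (\<lambda>h1 h2. tsum (\<Delta> h1) (\<lambda>p q. tsum (\<Delta> h2) (\<lambda>r s. M p q r s))) =
    tsum (\<Delta> h) (\<lambda>p y. tsum (\<Delta> y) (\<lambda>z s. tsum (\<Delta> z) (\<lambda>q r. M p q r s)))"
  unfolding coassoc_tsum[OF assms(1)] coassoc_tsum[OF assms(2)] ..

lemma coproduct_mult_tsum:
  assumes "bilin F"
  shows "tsum (\<Delta> (x * y)) F = tsum (\<Delta> x) (\<lambda>a b. tsum (\<Delta> y) (\<lambda>c d. F (a * c) (b * d)))"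
  using tensor2_eq_tsum[OF coproduct_mult assms] by (simp add: tsum_mult)

lemma coproduct_one_tsum: "bilin F \<Longrightarrow> tsum (\<Delta> 1) F = F 1 1"
  using tensor2_eq_tsum[OF coproduct_one] by simp

lemma counit_tsum:
  assumes "functional f"
  shows "tsum (\<Delta> x) (\<lambda>a b. \<epsilon> a * f b) = f x" "tsum (\<Delta> x) (\<lambda>a b. \<epsilon> b * f a) = f x"
proof -
  have "f (tsum (\<Delta> x) (\<lambda>a b. scale (\<epsilon> a) b)) = f x" "f (tsum (\<Delta> x) (\<lambda>a b. scale (\<epsilon> b) a)) = f x"
    by (simp_all add: tsum_def counit_left counit_right)
  then show "tsum (\<Delta> x) (\<lambda>a b. \<epsilon> a * f b) = f x" "tsum (\<Delta> x) (\<lambda>a b. \<epsilon> b * f a) = f x"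
    by (simp_all add: functional_apply_tsum[OF assms] functionalD[OF assms])
qed

lemma antipode_tsum:
  assumes "functional f"
  shows "tsum (\<Delta> x) (\<lambda>a b. f (S a * b)) = \<epsilon> x * f 1" "tsum (\<Delta> x) (\<lambda>a b. f (a * S b)) = \<epsilon> x * f 1"
proof -
  have "f (tsum (\<Delta> x) (\<lambda>a b. S a * b)) = \<epsilon> x * f 1" "f (tsum (\<Delta> x) (\<lambda>a b. a * S b)) = \<epsilon> x * f 1"
    by (simp_all add: tsum_def antipode_left antipode_right functionalD[OF assms])
  then show "tsum (\<Delta> x) (\<lambda>a b. f (S a * b)) = \<epsilon> x * f 1"
      "tsum (\<Delta> x) (\<lambda>a b. f (a * S b)) = \<epsilon> x * f 1"
    by (simp_all add: functional_apply_tsum[OF assms])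
qed

lemma antipode_one: "S 1 = 1"
proof (rule functional_ext)
  fix f assume f: "functional f"
  have "bilin (\<lambda>a b. f (S a * b))"
    by (intro multilinear_intros functional_comp[OF f])
  from coproduct_one_tsum[OF this] show "f (S 1) = f 1"
    by (simp add: antipode_tsum[OF f] counit_one)
qed

lemma counit_antipode: "\<epsilon> (S x) = \<epsilon> x"
proof -
  note lin = multilinear_intros
  have "\<epsilon> (S x) = tsum (\<Delta> x) (\<lambda>a b. \<epsilon> (S a * b))"
    using counit_tsum(2)[of "\<lambda>z. \<epsilon> (S z)" x] by (simp add: lin counit_mult mult.commute)
  then show ?thesis
    using antipode_tsum(1)[of \<epsilon> x] functional_counit[OF endo_id] by (simp add: counit_one)
qed

lemma antipode_mult: "S (x * y) = S y * S x"
proof (rule functional_ext)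
  fix f assume f: "functional f"
  note lin = multilinear_intros functional_comp[OF f]
  \<comment> \<open>Contract \<open>S (x\<^sub>1 y\<^sub>1) (x\<^sub>2 y\<^sub>2) (S y\<^sub>3 S x\<^sub>3)\<close> in two ways.\<close>
  define G where "G x1 x2 x3 y1 y2 y3 = f (S (x1 * y1) * (x2 * y2) * (S y3 * S x3))"
    for x1 x2 x3 y1 y2 y3
  have inner: "tsum (\<Delta> x') (\<lambda>x2 x3. tsum (\<Delta> y') (\<lambda>y2 y3. G x1 x2 x3 y1 y2 y3)) =
      \<epsilon> x' * (\<epsilon> y' * f (S (x1 * y1)))" for x' y' x1 y1
  proof -
    have "tsum (\<Delta> y') (\<lambda>y2 y3. G x1 x2 x3 y1 y2 y3) = \<epsilon> y' * f (S (x1 * y1) * (x2 * S x3))" for x2 x3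
      using antipode_tsum(2)[of "\<lambda>z. f (S (x1 * y1) * (x2 * z * S x3))" y']
      by (simp add: G_def mult.assoc lin)
    then show ?thesis
      using antipode_tsum(2)[of "\<lambda>z. f (S (x1 * y1) * z)" x']
      by (simp add: tsum_distrib_left[symmetric] lin)
  qed
  have outer: "tsum (\<Delta> x') (\<lambda>x1 x2. tsum (\<Delta> y') (\<lambda>y1 y2. G x1 x2 x3 y1 y2 y3)) =
      \<epsilon> x' * (\<epsilon> y' * f (S y3 * S x3))" for x' y' x3 y3
  proof -
    have "bilin (\<lambda>a b. f (S a * b * (S y3 * S x3)))"
      by (intro lin)
    from coproduct_mult_tsum[OF this, of x' y']
    show ?thesis
      using antipode_tsum(1)[of "\<lambda>z. f (z * (S y3 * S x3))" "x' * y'"]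
      by (simp add: G_def counit_mult lin mult.assoc)
  qed
  have "f (S (x * y)) = tsum (\<Delta> x) (\<lambda>x1 x'. tsum (\<Delta> y) (\<lambda>y1 y'. \<epsilon> x' * (\<epsilon> y' * f (S (x1 * y1)))))"
    by (simp add: tsum_distrib_left[symmetric] counit_tsum lin)
  also have "\<dots> = tsum (\<Delta> x) (\<lambda>x1 x'. tsum (\<Delta> x') (\<lambda>x2 x3.
      tsum (\<Delta> y) (\<lambda>y1 y'. tsum (\<Delta> y') (\<lambda>y2 y3. G x1 x2 x3 y1 y2 y3))))"
    unfolding inner[symmetric] by (intro tsum_cong tsum_swap)
  also have "\<dots> = tsum (\<Delta> x) (\<lambda>x' x3. tsum (\<Delta> x') (\<lambda>x1 x2.
      tsum (\<Delta> y) (\<lambda>y1 y'. tsum (\<Delta> y') (\<lambda>y2 y3. G x1 x2 x3 y1 y2 y3))))"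
    unfolding G_def by (rule coassoc_tsum[symmetric]) (intro lin)
  also have "\<dots> = tsum (\<Delta> x) (\<lambda>x' x3. tsum (\<Delta> x') (\<lambda>x1 x2.
      tsum (\<Delta> y) (\<lambda>y' y3. tsum (\<Delta> y') (\<lambda>y1 y2. G x1 x2 x3 y1 y2 y3))))"
    unfolding G_def by (rule tsum_cong, rule tsum_cong, rule coassoc_tsum[symmetric]) (intro lin)
  also have "\<dots> = tsum (\<Delta> x) (\<lambda>x' x3. tsum (\<Delta> y) (\<lambda>y' y3. \<epsilon> x' * (\<epsilon> y' * f (S y3 * S x3))))"
    unfolding outer[symmetric] by (intro tsum_cong tsum_swap)
  also have "\<dots> = f (S y * S x)"
    by (simp add: tsum_distrib_left[symmetric] counit_tsum lin)
  finally show "f (S (x * y)) = f (S y * S x)" .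
qed

section \<open>The adjoint action\<close>

abbreviation ad :: "'h \<Rightarrow> 'h \<Rightarrow> 'h" where
  "ad \<equiv> adjoint_action \<Delta> S"

lemma functional_ad:
  assumes "functional f"
  shows "f (ad h x) = tsum (\<Delta> h) (\<lambda>h1 h2. f (h1 * x * S h2))"
  unfolding adjoint_action_def tsum_def[symmetric] by (rule functional_apply_tsum[OF assms])

text \<open>A vector defined by a sum over \<open>\<Delta>\<close>, such as \<open>ad h x\<close>,
  is visibly linear only after a functional is applied; separation of points then removes the
  functional.\<close>

lemma endoI:
  assumes "\<And>f. functional f \<Longrightarrow> functional (\<lambda>x. f (g x))"
  shows "endo g"
  unfolding endo_iff
proof (intro conjI allI)
  show "g (x + y) = g x + g y" for x y
    by (rule functional_ext) (simp add: functionalD functionalD(1)[OF assms])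
  show "g (scale c x) = scale c (g x)" for c x
    by (rule functional_ext) (simp add: functionalD functionalD(2)[OF assms])
qed

lemma endo_ad:
  assumes "endo g"
  shows "endo (\<lambda>x. ad (g x) y)" "endo (\<lambda>x. ad h (g x))"
proof (rule_tac [!] endoI)
  fix f assume f: "functional f"
  note lin = multilinear_intros functional_comp[OF f]
  show "functional (\<lambda>x. f (ad (g x) y))" "functional (\<lambda>x. f (ad h (g x)))"
    unfolding functional_ad[OF f] by (intro lin assms)+
qed

lemma ad_one: "ad 1 x = x"
proof (rule functional_ext)
  fix f assume f: "functional f"
  have "bilin (\<lambda>a b. f (a * x * S b))"
    by (intro multilinear_intros functional_comp[OF f])
  from coproduct_one_tsum[OF this] show "f (ad 1 x) = f x"
    by (simp add: functional_ad[OF f] antipode_one)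
qed

lemma ad_mult: "ad (g * h) x = ad g (ad h x)"
proof (rule functional_ext)
  fix f assume f: "functional f"
  note lin = multilinear_intros functional_comp[OF f]
  have "bilin (\<lambda>a b. f (a * x * S b))"
    by (intro lin)
  from coproduct_mult_tsum[OF this, of g h]
  have "f (ad (g * h) x) =
      tsum (\<Delta> g) (\<lambda>a b. tsum (\<Delta> h) (\<lambda>c d. f (a * (c * x * S d) * S b)))"
    by (simp add: functional_ad[OF f] antipode_mult mult.assoc)
  also have "\<dots> = f (ad g (ad h x))"
    unfolding functional_ad[OF f]
    by (intro tsum_cong functional_ad[symmetric] lin)
  finally show "f (ad (g * h) x) = f (ad g (ad h x))" .
qed

end

section \<open>The universal R-matrix and the element Q\<close>

context fd_quasitriangular_hopf_algebra
begin

lemma hexagon1_tsum: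
  assumes "trilin F"
  shows "tsum R (\<lambda>a b. tsum (\<Delta> a) (\<lambda>a1 a2. F a1 a2 b)) =
    tsum R (\<lambda>a b. tsum R (\<lambda>c d. F a c (b * d)))"
  using tensor3_eq_tsum3[OF R_hexagon1 assms] by (simp add: tsum3_apply tsum3_mult tsum3_leg)

lemma hexagon2_tsum:
  assumes "trilin F"
  shows "tsum R (\<lambda>a b. tsum (\<Delta> b) (\<lambda>b1 b2. F a b1 b2)) =
    tsum R (\<lambda>a b. tsum R (\<lambda>c d. F (a * c) d b))"
  using tensor3_eq_tsum3[OF R_hexagon2 assms] by (simp add: tsum3_apply tsum3_mult tsum3_leg)

lemma R_intertwines_tsum:
  assumes "bilin F"
  shows "tsum (\<Delta> x) (\<lambda>p q. tsum R (\<lambda>a b. F (q * a) (p * b))) =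
    tsum R (\<lambda>a b. tsum (\<Delta> x) (\<lambda>p q. F (a * p) (b * q)))"
  using tensor2_eq_tsum[OF R_intertwines assms] by (simp add: tsum_mult tsum_flip)

lemma R_counit_left:
  assumes f: "functional f"
  shows "tsum R (\<lambda>a b. \<epsilon> a * f b) = f 1"
proof -
  \<comment> \<open>\<open>(\<epsilon> \<otimes> id) R\<close> is idempotent by the hexagon identity and invertible, hence \<open>1\<close>.\<close>
  note lin = multilinear_intros functional_comp[OF f]
  obtain R' where R': "tensor2_eq scale (tensor2_mult R R') [(1, 1)]"
    using R_invertible by auto
  have inv: "tsum R (\<lambda>a b. \<epsilon> a * tsum R' (\<lambda>c d. \<epsilon> c * g (b * d))) = g 1"
    if g: "functional g" for g
  proof -
    have "bilin (\<lambda>a b. \<epsilon> a * g b)"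
      by (intro multilinear_intros functional_comp[OF g])
    from tensor2_eq_tsum[OF R' this] show ?thesis
      by (simp add: tsum_mult tsum_distrib_left counit_mult counit_one mult.assoc)
  qed
  have idem: "tsum R (\<lambda>a b. \<epsilon> a * g b) = tsum R (\<lambda>a b. \<epsilon> a * tsum R (\<lambda>c d. \<epsilon> c * g (b * d)))"
    if g: "functional g" for g
  proof -
    have "trilin (\<lambda>a1 a2 b. \<epsilon> a1 * (\<epsilon> a2 * g b))"
      by (intro multilinear_intros functional_comp[OF g])
    from hexagon1_tsum[OF this] show ?thesis
      by (simp add: tsum_distrib_left counit_tsum functional_mult functional_counit endo_id)
  qed
  \<comment> \<open>\<open>f\<close> after multiplication by the inverse of
    \<open>(\<epsilon> \<otimes> id) R\<close>; using it in \<open>idem\<close> cancels one of the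
    two copies of \<open>R\<close>.\<close>
  define f' where "f' z = tsum R' (\<lambda>c d. \<epsilon> c * f (z * d))" for z
  have f': "functional f'"
    unfolding f'_def by (intro lin)
  have "f 1 = tsum R (\<lambda>a b. \<epsilon> a * f' b)"
    unfolding f'_def by (rule inv[OF f, symmetric])
  also have "\<dots> = tsum R (\<lambda>a b. \<epsilon> a * tsum R (\<lambda>c d. \<epsilon> c * f' (b * d)))"
    by (rule idem[OF f'])
  also have "\<dots> = tsum R (\<lambda>a b. \<epsilon> a * f b)"
    using inv[of "\<lambda>z. f (b * z)" for b] by (simp add: f'_def mult.assoc lin)
  finally show ?thesis by simp
qed

text \<open>The argument of \<open>R_counit_left\<close> with the second hexagon identity. That
  identity reverses the second legs, hence the order of the counits in \<open>idem\<close>.\<close>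

lemma R_counit_right:
  assumes f: "functional f"
  shows "tsum R (\<lambda>a b. \<epsilon> b * f a) = f 1"
proof -
  note lin = multilinear_intros functional_comp[OF f]
  obtain R' where R': "tensor2_eq scale (tensor2_mult R R') [(1, 1)]"
    using R_invertible by auto
  have inv: "tsum R (\<lambda>a b. \<epsilon> b * tsum R' (\<lambda>c d. \<epsilon> d * g (a * c))) = g 1"
    if g: "functional g" for g
  proof -
    have "bilin (\<lambda>a b. \<epsilon> b * g a)"
      by (intro multilinear_intros functional_comp[OF g])
    from tensor2_eq_tsum[OF R' this] show ?thesis
      by (simp add: tsum_mult tsum_distrib_left counit_mult counit_one mult.assoc)
  qed
  have idem: "tsum R (\<lambda>a b. \<epsilon> b * g a) = tsum R (\<lambda>a b. \<epsilon> b * tsum R (\<lambda>c d. \<epsilon> d * g (a * c)))"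
    if g: "functional g" for g
  proof -
    have "trilin (\<lambda>a b1 b2. \<epsilon> b2 * (\<epsilon> b1 * g a))"
      by (intro multilinear_intros functional_comp[OF g])
    from hexagon2_tsum[OF this] show ?thesis
      by (simp add: tsum_distrib_left counit_tsum functional_mult functional_counit endo_id)
  qed
  define f' where "f' z = tsum R' (\<lambda>c d. \<epsilon> d * f (z * c))" for z
  have f': "functional f'"
    unfolding f'_def by (intro lin)
  have "f 1 = tsum R (\<lambda>a b. \<epsilon> b * f' a)"
    unfolding f'_def by (rule inv[OF f, symmetric])
  also have "\<dots> = tsum R (\<lambda>a b. \<epsilon> b * tsum R (\<lambda>c d. \<epsilon> d * f' (a * c)))"
    by (rule idem[OF f'])
  also have "\<dots> = tsum R (\<lambda>a b. \<epsilon> b * f a)"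
    using inv[of "\<lambda>z. f (b * z)" for b] by (simp add: f'_def mult.assoc lin)
  finally show ?thesis by simp
qed

text \<open>A hexagon identity is tested on a form that multiplies one leg of the coproduct by the
  antipode of the other, so the coproduct collapses to a counit, which \<open>R\<close> absorbs. The
  first identity makes \<open>(S \<otimes> id) R\<close> a right inverse of \<open>R\<close>; the
  second is its analogue with opposite multiplication in the second factor.\<close>

lemma R_antipode_inverse:
  assumes F: "bilin F"
  shows "tsum R (\<lambda>a b. tsum R (\<lambda>c d. F (a * S c) (b * d))) = F 1 1"
    and "tsum R (\<lambda>a b. tsum R (\<lambda>c d. F (a * c) (d * S b))) = F 1 1"
proof -
  note lin = multilinear_intros bilin_comp[OF F]
  have "trilin (\<lambda>x y z. F (x * S y) z)"
    by (intro lin)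
  from hexagon1_tsum[OF this]
  have "tsum R (\<lambda>a b. tsum R (\<lambda>c d. F (a * S c) (b * d))) = tsum R (\<lambda>a b. \<epsilon> a * F 1 b)"
    using antipode_tsum(2)[of "\<lambda>z. F z b" for b] by (simp add: lin)
  then show "tsum R (\<lambda>a b. tsum R (\<lambda>c d. F (a * S c) (b * d))) = F 1 1"
    using R_counit_left[of "F 1"] by (simp add: lin)
  have "trilin (\<lambda>x y z. F x (y * S z))"
    by (intro lin)
  from hexagon2_tsum[OF this]
  have "tsum R (\<lambda>a b. tsum R (\<lambda>c d. F (a * c) (d * S b))) = tsum R (\<lambda>a b. \<epsilon> b * F a 1)"
    using antipode_tsum(2)[of "\<lambda>z. F a z" for a] by (simp add: lin)
  then show "tsum R (\<lambda>a b. tsum R (\<lambda>c d. F (a * c) (d * S b))) = F 1 1"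
    using R_counit_right[of "\<lambda>z. F z 1"] by (simp add: lin)
qed

lemma R_antipode_antipode:
  assumes F: "bilin F"
  shows "tsum R (\<lambda>a b. F (S a) (S b)) = tsum R F"
proof -
  \<comment> \<open>Both sides are inverse to \<open>(S \<otimes> id) R\<close>.\<close>
  note lin = multilinear_intros bilin_comp[OF F]
  have "tsum R (\<lambda>a b. F (S a) (S b)) =
      tsum R (\<lambda>a b. tsum R (\<lambda>s s'. tsum R (\<lambda>t t'. F (s * S t * S a) (s' * t' * S b))))"
    using R_antipode_inverse(1)[of "\<lambda>x y. F (x * S a) (y * S b)" for a b] by (simp add: lin)
  also have "\<dots> = tsum R (\<lambda>s s'. tsum R (\<lambda>a b. tsum R (\<lambda>t t'. F (s * S (a * t)) (s' * (t' * S b)))))"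
    unfolding antipode_mult mult.assoc by (rule tsum_swap)
  also have "\<dots> = tsum R F"
    using R_antipode_inverse(2)[of "\<lambda>x y. F (s * S x) (s' * y)" for s s']
    by (simp add: lin antipode_one)
  finally show ?thesis .
qed

abbreviation Q :: "('h \<times> 'h) list" where
  "Q \<equiv> Q_element R"

lemma tsum_Q: "tsum Q F = tsum R (\<lambda>a b. tsum R (\<lambda>c d. F (b * c) (a * d)))"
  by (simp add: Q_element_def tsum_mult tsum_flip)

lemma Q_counit:
  assumes "functional f"
  shows "tsum Q (\<lambda>a b. \<epsilon> a * f b) = f 1" "tsum Q (\<lambda>a b. \<epsilon> b * f a) = f 1"
proof -
  note lin = multilinear_intros functional_comp[OF assms]
  have "tsum Q (\<lambda>a b. \<epsilon> a * f b) = tsum R (\<lambda>a b. \<epsilon> b * tsum R (\<lambda>c d. \<epsilon> c * f (a * d)))"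
    by (simp add: tsum_Q tsum_distrib_left counit_mult mult.assoc)
  then show "tsum Q (\<lambda>a b. \<epsilon> a * f b) = f 1"
    using R_counit_left[of "\<lambda>z. f (a * z)" for a] by (simp add: lin R_counit_right)
  have "tsum Q (\<lambda>a b. \<epsilon> b * f a) = tsum R (\<lambda>a b. \<epsilon> a * tsum R (\<lambda>c d. \<epsilon> d * f (b * c)))"
    by (simp add: tsum_Q tsum_distrib_left counit_mult mult.assoc)
  then show "tsum Q (\<lambda>a b. \<epsilon> b * f a) = f 1"
    using R_counit_right[of "\<lambda>z. f (a * z)" for a] by (simp add: lin R_counit_left)
qed

text \<open>Moving past \<open>R\<close> turns the coproduct into its flip, and moving past
  \<open>R\<^sub>2\<^sub>1\<close> turns it back.\<close>

lemma Q_commutes_coproduct: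
  assumes F: "bilin F"
  shows "tsum Q (\<lambda>a b. tsum (\<Delta> x) (\<lambda>p q. F (a * p) (b * q))) =
    tsum Q (\<lambda>a b. tsum (\<Delta> x) (\<lambda>p q. F (p * a) (q * b)))"
proof -
  note lin = multilinear_intros bilin_comp[OF F]
  have "tsum Q (\<lambda>a b. tsum (\<Delta> x) (\<lambda>p q. F (a * p) (b * q))) =
      tsum R (\<lambda>a b. tsum (\<Delta> x) (\<lambda>p q. tsum R (\<lambda>c d. F (b * q * c) (a * p * d))))"
    using R_intertwines_tsum[of "\<lambda>y z. F (b * y) (a * z)" x for a b]
    by (simp add: tsum_Q lin mult.assoc)
  also have "\<dots> = tsum (\<Delta> x) (\<lambda>p q. tsum R (\<lambda>a b. tsum R (\<lambda>c d. F (p * b * c) (q * a * d))))"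
    using R_intertwines_tsum[of "\<lambda>z y. tsum R (\<lambda>c d. F (y * c) (z * d))" x] by (simp add: lin)
  also have "\<dots> = tsum Q (\<lambda>a b. tsum (\<Delta> x) (\<lambda>p q. F (p * a) (q * b)))"
    by (subst tsum_swap) (simp add: tsum_Q mult.assoc)
  finally show ?thesis .
qed

text \<open>\<open>S \<otimes> S\<close> reverses products and fixes \<open>R\<close>, so it sends
  \<open>R\<^sub>2\<^sub>1 R\<close> to \<open>R R\<^sub>2\<^sub>1\<close>, the flip of
  \<open>Q\<close>.\<close>

lemma Q_antipode_antipode:
  assumes F: "bilin F"
  shows "tsum Q (\<lambda>a b. F (S a) (S b)) = tsum Q (\<lambda>a b. F b a)"
proof -
  note lin = multilinear_intros bilin_comp[OF F]
  have "tsum Q (\<lambda>a b. F (S a) (S b)) = tsum R (\<lambda>a b. tsum R (\<lambda>c d. F (S c * S b) (S d * S a)))"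
    by (simp add: tsum_Q antipode_mult)
  also have "\<dots> = tsum R (\<lambda>a b. tsum R (\<lambda>c d. F (c * S b) (d * S a)))"
    using R_antipode_antipode[of "\<lambda>x y. F (x * S b) (y * S a)" for a b] by (simp add: lin)
  also have "\<dots> = tsum R (\<lambda>a b. tsum R (\<lambda>c d. F (c * b) (d * a)))"
    using R_antipode_antipode[of "\<lambda>x y. tsum R (\<lambda>c d. F (c * y) (d * x))"] by (simp add: lin)
  also have "\<dots> = tsum Q (\<lambda>a b. F b a)"
    by (subst tsum_swap) (simp add: tsum_Q)
  finally show ?thesis .
qed

section \<open>The braided coproduct\<close>

text \<open>The coproduct is multiplicative, so each factor of \<open>R\<^sub>2\<^sub>1 R\<close>
  splits by its own hexagon identity. Of the four resulting copies of \<open>R\<close>, the middle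
  two reassemble to \<open>Q\<close>.\<close>

lemma Q_coproduct:
  assumes F: "trilin F"
  shows "tsum Q (\<lambda>q p. tsum (\<Delta> p) (\<lambda>h1 h2. F q h1 h2)) =
    tsum R (\<lambda>a b. tsum Q (\<lambda>q p. tsum R (\<lambda>c d. F (b * q * c) (a * d) p)))"
proof -
  note lin = multilinear_intros trilin_comp[OF F]
  have "tsum Q (\<lambda>q p. tsum (\<Delta> p) (\<lambda>h1 h2. F q h1 h2)) =
      tsum R (\<lambda>x y. tsum R (\<lambda>x' y'. tsum (\<Delta> x) (\<lambda>x1 x2. tsum (\<Delta> y') (\<lambda>y1 y2.
        F (y * x') (x1 * y1) (x2 * y2)))))"
    using coproduct_mult_tsum[of "F q" for q] by (simp add: tsum_Q lin)
  also have "\<dots> = tsum R (\<lambda>x y. tsum (\<Delta> x) (\<lambda>x1 x2. tsum R (\<lambda>x' y'. tsum (\<Delta> y') (\<lambda>y1 y2.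
        F (y * x') (x1 * y1) (x2 * y2)))))"
    by (intro tsum_cong tsum_swap)
  also have "\<dots> = tsum R (\<lambda>x y. tsum (\<Delta> x) (\<lambda>x1 x2. tsum R (\<lambda>a b. tsum R (\<lambda>c d.
        F (y * (a * c)) (x1 * d) (x2 * b)))))"
    using hexagon2_tsum[of "\<lambda>x' y1 y2. F (y * x') (x1 * y1) (x2 * y2)" for y x1 x2]
    by (simp add: lin)
  also have "\<dots> = tsum R (\<lambda>x1 y1. tsum R (\<lambda>x2 y2. tsum R (\<lambda>a b. tsum R (\<lambda>c d.
        F (y1 * y2 * (a * c)) (x1 * d) (x2 * b)))))"
    by (rule hexagon1_tsum) (intro lin)
  finally show ?thesis
    by (simp add: tsum_Q mult.assoc)
qed

abbreviation braided_coproduct :: "'h \<Rightarrow> ('h \<times> 'h) list" where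
  "braided_coproduct \<equiv> bcoproduct (transmutation scale \<Delta> \<epsilon> S R)"

lemma tsum_braided_coproduct:
  "tsum (braided_coproduct h) F =
    tsum (\<Delta> h) (\<lambda>h1 h2. tsum R (\<lambda>r1 r2. F (h1 * S r2) (ad r1 h2)))"
  by (simp add: transmutation_def tsum_concat_map tsum_map case_prod_unfold)
    (simp add: tsum_def case_prod_unfold)

lemma functional_braided_coproduct:
  assumes "bilin F" "endo g"
  shows "functional (\<lambda>x. tsum (braided_coproduct (g x)) F)"
  unfolding tsum_braided_coproduct
  by (intro multilinear_intros bilin_comp[OF assms(1)] assms(2) endo_ad)

text \<open>By \<open>Q_coproduct\<close> the ordinary coproduct leaves a \<open>Q\<close> between
  two copies of \<open>R\<close>; the braiding contributes two more copies. Once \<open>Q\<close>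
  has moved to the right, the braiding copies cancel and the outer two form the second
  \<open>Q\<close>.\<close>

lemma Q_braided_coproduct:
  assumes F: "trilin F"
  shows "tsum Q (\<lambda>q p. tsum (braided_coproduct p) (\<lambda>x y. F q x y)) =
    tsum Q (\<lambda>a b. tsum Q (\<lambda>c d. F (a * c) b d))"
proof -
  note lin = multilinear_intros trilin_comp[OF F]
  \<comment> \<open>The hexagon splits the copy of \<open>R\<close> whose first leg acts by
    \<open>ad\<close>. This turns \<open>S r2\<close> into \<open>S z * S w\<close>, and
    \<open>R_antipode_antipode\<close> then strips the antipodes from \<open>v\<close> and
    \<open>z\<close> together.\<close>
  have coproduct: "tsum (braided_coproduct p) (\<lambda>x y. F q x y) =
    tsum (\<Delta> p) (\<lambda>h1 h2. tsum R (\<lambda>u w. tsum R (\<lambda>v z. F q (h1 * z * S w) (u * h2 * v))))" for q p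
    unfolding tsum_braided_coproduct
  proof (rule tsum_cong)
    fix h1 h2
    have "tsum R (\<lambda>r1 r2. F q (h1 * S r2) (ad r1 h2)) =
        tsum R (\<lambda>r1 r2. tsum (\<Delta> r1) (\<lambda>u v. F q (h1 * S r2) (u * h2 * S v)))"
      by (intro tsum_cong functional_ad lin)
    also have "\<dots> = tsum R (\<lambda>u w. tsum R (\<lambda>v z. F q (h1 * S (w * z)) (u * h2 * S v)))"
      by (rule hexagon1_tsum) (intro lin)
    also have "\<dots> = tsum R (\<lambda>u w. tsum R (\<lambda>v z. F q (h1 * z * S w) (u * h2 * v)))"
      using R_antipode_antipode[of "\<lambda>v z. F q (h1 * z * S w) (u * h2 * v)" for u w]
      by (simp add: lin antipode_mult mult.assoc)
    finally show "tsum R (\<lambda>r1 r2. F q (h1 * S r2) (ad r1 h2)) =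
        tsum R (\<lambda>u w. tsum R (\<lambda>v z. F q (h1 * z * S w) (u * h2 * v)))" .
  qed
  \<comment> \<open>\<open>Q\<close> commutes past the coproduct that the hexagon identity makes of two copies of \<open>R\<close>.\<close>
  have swap: "tsum Q (\<lambda>q p. tsum R (\<lambda>c d. tsum R (\<lambda>v z. F (b * q * c) (a * (d * z) * s) (u * p * v)))) =
      tsum Q (\<lambda>q p. tsum R (\<lambda>c d. tsum R (\<lambda>v z. F (b * c * q) (a * (d * z) * s) (u * v * p))))"
    for a b s u
  proof -
    have "tsum Q (\<lambda>q p. tsum R (\<lambda>c d. tsum R (\<lambda>v z. F (b * q * c) (a * (d * z) * s) (u * p * v)))) =
        tsum Q (\<lambda>q p. tsum R (\<lambda>k l. tsum (\<Delta> k) (\<lambda>c v. F (b * (q * c)) (a * l * s) (u * (p * v)))))"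
      using hexagon1_tsum[of "\<lambda>c v e. F (b * (q * c)) (a * e * s) (u * (p * v))" for q p]
      by (simp add: lin mult.assoc)
    also have "\<dots> = tsum R (\<lambda>k l. tsum Q (\<lambda>q p. tsum (\<Delta> k) (\<lambda>c v. F (b * (q * c)) (a * l * s) (u * (p * v)))))"
      by (rule tsum_swap)
    also have "\<dots> = tsum R (\<lambda>k l. tsum Q (\<lambda>q p. tsum (\<Delta> k) (\<lambda>c v. F (b * (c * q)) (a * l * s) (u * (v * p)))))"
      by (intro tsum_cong Q_commutes_coproduct) (intro lin)
    also have "\<dots> = tsum Q (\<lambda>q p. tsum R (\<lambda>k l. tsum (\<Delta> k) (\<lambda>c v. F (b * (c * q)) (a * l * s) (u * (v * p)))))"
      by (rule tsum_swap)
    also have "\<dots> = tsum Q (\<lambda>q p. tsum R (\<lambda>c d. tsum R (\<lambda>v z. F (b * c * q) (a * (d * z) * s) (u * v * p))))"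
      using hexagon1_tsum[of "\<lambda>c v e. F (b * (c * q)) (a * e * s) (u * (v * p))" for q p]
      by (simp add: lin mult.assoc)
    finally show ?thesis .
  qed
  have "tsum Q (\<lambda>q p. tsum (braided_coproduct p) (\<lambda>x y. F q x y)) =
      tsum R (\<lambda>a b. tsum Q (\<lambda>q p. tsum R (\<lambda>c d. tsum R (\<lambda>u w. tsum R (\<lambda>v z.
        F (b * q * c) (a * d * z * S w) (u * p * v))))))"
    unfolding coproduct by (rule Q_coproduct) (intro lin)
  also have "\<dots> = tsum R (\<lambda>a b. tsum R (\<lambda>u w. tsum Q (\<lambda>q p. tsum R (\<lambda>c d. tsum R (\<lambda>v z.
        F (b * q * c) (a * (d * z) * S w) (u * p * v))))))"
    unfolding mult.assoc by (intro tsum_cong tsum_rotate)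
  also have "\<dots> = tsum R (\<lambda>a b. tsum R (\<lambda>u w. tsum Q (\<lambda>q p. tsum R (\<lambda>c d. tsum R (\<lambda>v z.
        F (b * c * q) (a * (d * z) * S w) (u * v * p))))))"
    unfolding swap ..
  also have "\<dots> = tsum R (\<lambda>a b. tsum Q (\<lambda>q p. tsum R (\<lambda>c d. tsum R (\<lambda>u w. tsum R (\<lambda>v z.
        F (b * c * q) (a * d * (z * S w)) (u * v * p))))))"
    unfolding mult.assoc by (intro tsum_cong tsum_rotate[symmetric])
  \<comment> \<open>The factors \<open>u * v\<close> and \<open>z * S w\<close> are now adjacent, so
    the copies of \<open>R\<close> coming from the braiding multiply to 1.\<close>
  also have "\<dots> = tsum R (\<lambda>a b. tsum Q (\<lambda>q p. tsum R (\<lambda>c d. F (b * c * q) (a * d) p)))"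
    using R_antipode_inverse(2)[of "\<lambda>x y. F (b * c * q) (a * d * y) (x * p)" for a b c d q p]
    by (simp add: lin)
  also have "\<dots> = tsum R (\<lambda>a b. tsum R (\<lambda>c d. tsum Q (\<lambda>q p. F (b * c * q) (a * d) p)))"
    by (intro tsum_cong tsum_swap)
  also have "\<dots> = tsum Q (\<lambda>a b. tsum Q (\<lambda>c d. F (a * c) b d))"
    by (simp add: tsum_Q[of "\<lambda>a b. tsum Q (\<lambda>c d. F (a * c) b d)"])
  finally show ?thesis .
qed

section \<open>The metric element and its inverse form\<close>

abbreviation Theta :: "('h \<times> 'h) list" where
  "Theta \<equiv> metric_element S R"

lemma metric_tsum: "tsum Theta F = tsum Q (\<lambda>a b. F (S a) b)"
  by (simp add: metric_element_def tsum_map) (simp add: tsum_def case_prod_unfold)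

text \<open>Since \<open>S a * S q = S (q * a)\<close>, the inner legs \<open>q\<close> and
  \<open>r\<close> of the fourfold coproduct multiply \<open>Q\<close> from the left. Commuting them
  to its right brings them into the products \<open>p * S q\<close> and \<open>r * S s\<close>,
  which collapse to counits.\<close>

lemma metric_invariant_tsum:
  assumes F: "bilin F"
  shows "tsum (\<Delta> h) (\<lambda>h1 h2. tsum Theta (\<lambda>a b. F (ad h1 a) (ad h2 b))) = \<epsilon> h * tsum Theta F"
proof -
  note lin = multilinear_intros bilin_comp[OF F]
  have ad: "F (ad x a) (ad y b) =
      tsum (\<Delta> x) (\<lambda>p q. tsum (\<Delta> y) (\<lambda>r s. F (p * a * S q) (r * b * S s)))" for x y a b
    using functional_ad[of "\<lambda>z. F z (ad y b)"] functional_ad[of "F z" for z] by (simp add: lin)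
  have "tsum (\<Delta> h) (\<lambda>h1 h2. tsum Theta (\<lambda>a b. F (ad h1 a) (ad h2 b))) =
      tsum (\<Delta> h) (\<lambda>h1 h2. tsum (\<Delta> h1) (\<lambda>p q. tsum (\<Delta> h2) (\<lambda>r s.
        tsum Q (\<lambda>a b. F (p * S (q * a)) (r * b * S s)))))"
    unfolding metric_tsum ad antipode_mult mult.assoc by (intro tsum_cong tsum_rotate[symmetric])
  also have "\<dots> = tsum (\<Delta> h) (\<lambda>p y. tsum (\<Delta> y) (\<lambda>z s. tsum (\<Delta> z) (\<lambda>q r.
        tsum Q (\<lambda>a b. F (p * S (q * a)) (r * b * S s)))))"
    by (rule coassoc4_tsum) (intro lin)+
  also have "\<dots> = tsum (\<Delta> h) (\<lambda>p y. tsum (\<Delta> y) (\<lambda>z s. tsum Q (\<lambda>a b. tsum (\<Delta> z) (\<lambda>q r.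
        F (p * S (q * a)) (r * b * S s)))))"
    by (intro tsum_cong tsum_swap)
  also have "\<dots> = tsum (\<Delta> h) (\<lambda>p y. tsum (\<Delta> y) (\<lambda>z s. tsum Q (\<lambda>a b. tsum (\<Delta> z) (\<lambda>q r.
        F (p * S (a * q)) (b * r * S s)))))"
    by (intro tsum_cong Q_commutes_coproduct[symmetric]) (intro lin)
  also have "\<dots> = tsum (\<Delta> h) (\<lambda>p y. tsum (\<Delta> y) (\<lambda>z s. tsum (\<Delta> z) (\<lambda>q r. tsum Q (\<lambda>a b.
        F (p * S (a * q)) (b * r * S s)))))"
    by (intro tsum_cong tsum_swap)
  also have "\<dots> = tsum (\<Delta> h) (\<lambda>h1 h2. tsum (\<Delta> h1) (\<lambda>p q. tsum (\<Delta> h2) (\<lambda>r s.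
        tsum Q (\<lambda>a b. F (p * S (a * q)) (b * r * S s)))))"
    by (rule coassoc4_tsum[symmetric]) (intro lin)+
  also have "\<dots> = tsum (\<Delta> h) (\<lambda>h1 h2. tsum Q (\<lambda>a b.
        tsum (\<Delta> h1) (\<lambda>p q. tsum (\<Delta> h2) (\<lambda>r s. F (p * S q * S a) (b * (r * S s))))))"
    unfolding antipode_mult mult.assoc by (intro tsum_cong tsum_rotate)
  also have "\<dots> = tsum (\<Delta> h) (\<lambda>h1 h2. tsum Q (\<lambda>a b. \<epsilon> h2 * (\<epsilon> h1 * F (S a) b)))"
    using antipode_tsum(2)[of "\<lambda>z. F (z * S a) b" for a b]
      antipode_tsum(2)[of "\<lambda>z. F y (b * z)" for y b]
    by (simp add: lin tsum_distrib_left[symmetric])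
  also have "\<dots> = tsum (\<Delta> h) (\<lambda>h1 h2. \<epsilon> h2 * (\<epsilon> h1 * tsum Theta F))"
    by (simp add: metric_tsum tsum_distrib_left)
  also have "\<dots> = \<epsilon> h * tsum Theta F"
    by (rule counit_tsum) (intro lin)
  finally show ?thesis .
qed

text \<open>Evaluate \<open>K\<close> on \<open>S h1 * h2\<close> and \<open>h3\<close>: invariance
  of \<Theta> contracts the last two legs to \<open>K (S h) 1\<close>, and the antipode axiom
  contracts the first two to \<open>K 1 h\<close>.\<close>

lemma metric_ad_transpose:
  assumes F: "bilin F"
  shows "tsum Theta (\<lambda>a b. F a (ad h b)) = tsum Theta (\<lambda>a b. F (ad (S h) a) b)"
proof -
  note lin = multilinear_intros bilin_comp[OF F] endo_ad
  define K where "K x y = tsum Theta (\<lambda>a b. F (ad x a) (ad y b))" for x y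
  have K: "bilin K"
    unfolding K_def by (intro lin)
  note K_lin = multilinear_intros bilin_comp[OF K]
  have "K (S h) 1 = tsum (\<Delta> h) (\<lambda>h1 y. \<epsilon> y * K (S h1) 1)"
    by (rule counit_tsum[symmetric]) (intro K_lin)
  also have "\<dots> = tsum (\<Delta> h) (\<lambda>h1 y. tsum (\<Delta> y) (\<lambda>h2 h3. K (S h1 * h2) h3))"
    using metric_invariant_tsum[of "\<lambda>x y. F (ad (S h1) x) y" for h1]
    by (simp add: K_def ad_mult ad_one lin)
  also have "\<dots> = tsum (\<Delta> h) (\<lambda>y h3. tsum (\<Delta> y) (\<lambda>h1 h2. K (S h1 * h2) h3))"
    by (rule coassoc_tsum[symmetric]) (intro K_lin)
  also have "\<dots> = tsum (\<Delta> h) (\<lambda>y h3. \<epsilon> y * K 1 h3)"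
    by (intro tsum_cong antipode_tsum(1)) (intro K_lin)
  also have "\<dots> = K 1 h"
    by (rule counit_tsum) (intro K_lin)
  finally show ?thesis
    by (simp add: K_def ad_one)
qed

text \<open>This is \<open>Q_braided_coproduct\<close> after the antipode on the first leg, which
  reverses the product there; hence the exchanged copies of \<Theta>. Pairing with \<theta> yields
  the second Hadamard identity.\<close>

lemma metric_coproduct_right:
  assumes F: "trilin F"
  shows "tsum Theta (\<lambda>a b. tsum (braided_coproduct b) (\<lambda>x y. F a x y)) =
    tsum Theta (\<lambda>a b. tsum Theta (\<lambda>c d. F (a * c) d b))"
proof -
  note lin = multilinear_intros trilin_comp[OF F]
  have "tsum Theta (\<lambda>a b. tsum (braided_coproduct b) (\<lambda>x y. F a x y)) =
      tsum Q (\<lambda>a b. tsum Q (\<lambda>c d. F (S (a * c)) b d))"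
    unfolding metric_tsum by (rule Q_braided_coproduct) (intro lin)
  also have "\<dots> = tsum Theta (\<lambda>a b. tsum Theta (\<lambda>c d. F (a * c) d b))"
    unfolding metric_tsum antipode_mult by (rule tsum_swap)
  finally show ?thesis .
qed

end

section \<open>Consequences of factorisability\<close>

context fd_factorisable_hopf_algebra
begin

lemma factorisable_ex1:
  "\<exists>!f. functional f \<and> tsum Q (\<lambda>a b. scale (f a) b) = x"
proof -
  have "bij_betw (\<lambda>f. tsum Q (\<lambda>a b. scale (f a) b)) {f. functional f} UNIV"
    using factorisable by (simp add: tsum_def functional_def)
  then have inj: "inj_on (\<lambda>f. tsum Q (\<lambda>a b. scale (f a) b)) {f. functional f}"
    and surj: "x \<in> (\<lambda>f. tsum Q (\<lambda>a b. scale (f a) b)) ` {f. functional f}"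
    by (simp_all add: bij_betw_def)
  from surj obtain f where f: "functional f" "tsum Q (\<lambda>a b. scale (f a) b) = x"
    by (elim imageE) simp
  show ?thesis
  proof (rule ex1I[of _ f])
    show "g = f" if "functional g \<and> tsum Q (\<lambda>a b. scale (g a) b) = x" for g
      using that f by (intro inj_onD[OF inj]) simp_all
  qed (use f in simp)
qed

lemma antipode_bij: "bij S"
proof -
  have S: "endo S"
    using endo_antipode[OF endo_id] .
  have "surj S"
  proof (rule ccontr)
    assume "\<not> surj S"
    have "S 0 = 0"
      using S[unfolded endo_iff, THEN conjunct2, rule_format, of 0 0] by simp
    then have "subspace (range S)"
      using S rangeI[of S 0] rangeI[of S "a + b" for a b] rangeI[of S "scale c a" for c a]
      by (intro subspaceI) (auto simp: endo_iff)
    then obtain f x where f: "functional f" "\<And>x. f (S x) = 0" and x: "f x \<noteq> 0"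
      using functionals_separate_subspace[of "range S"] \<open>\<not> surj S\<close> by auto
    obtain g where g: "functional g" "tsum Q (\<lambda>a b. scale (g a) b) = x"
      using ex1_implies_ex[OF factorisable_ex1[of x]] by auto
    have "bilin (\<lambda>x y. f x * g y)"
      by (intro multilinear_intros f(1) g(1))
    from Q_antipode_antipode[OF this] have "tsum Q (\<lambda>a b. f b * g a) = 0"
      by (simp add: f(2))
    moreover have "f x = tsum Q (\<lambda>a b. f b * g a)"
      unfolding g(2)[symmetric]
      by (simp add: functional_apply_tsum[OF f(1)] functionalD[OF f(1)] mult.commute)
    ultimately show False
      using x by simp
  qed
  with endo_surj_imp_inj[OF S] show ?thesis
    by (simp add: bij_def)
qed

lemma antipode_inv: "inv S (S x) = x" "S (inv S x) = x"
  using antipode_bij by (simp_all add: bij_is_inj bij_is_surj surj_f_inv_f)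

lemma endo_antipode_inv: "endo g \<Longrightarrow> endo (\<lambda>x. inv S (g x))"
proof -
  have S: "endo S"
    using endo_antipode[OF endo_id] .
  have "S (inv S x + inv S y) = x + y" "S (scale c (inv S x)) = scale c x" for c x y
    using S by (simp_all add: endo_iff antipode_inv)
  from this[THEN arg_cong[where f = "inv S"]]
  have "inv S (x + y) = inv S x + inv S y" "inv S (scale c x) = scale c (inv S x)" for c x y
    by (simp_all add: antipode_inv)
  then show "endo g \<Longrightarrow> endo (\<lambda>x. inv S (g x))"
    by (simp add: endo_iff)
qed

text \<open>The known coproduct formula concerns the second leg of \<open>Q\<close>. Writing the
  second leg of \<Theta> as \<open>S (inv S b)\<close> makes \<open>S \<otimes> S\<close> act on
  \<open>Q\<close>, which flips the legs; after the formula is applied, both copies of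
  \<open>Q\<close> are flipped back.\<close>

lemma metric_coproduct_left:
  assumes F: "trilin F"
  shows "tsum Theta (\<lambda>a b. tsum (braided_coproduct a) (\<lambda>x y. F x y b)) =
    tsum Theta (\<lambda>a b. tsum Theta (\<lambda>c d. F c a (b * d)))"
proof -
  note lin = multilinear_intros trilin_comp[OF F] endo_antipode_inv functional_braided_coproduct
  define G where "G x y z = F x y (inv S z)" for x y z
  have G: "trilin G"
    unfolding G_def by (intro lin)
  note G_lin = multilinear_intros trilin_comp[OF G] functional_braided_coproduct
  have FG: "F x y z = G x y (S z)" for x y z
    by (simp add: G_def antipode_inv)
  have "tsum Theta (\<lambda>a b. tsum (braided_coproduct a) (\<lambda>x y. F x y b)) =
      tsum Q (\<lambda>a b. tsum (braided_coproduct b) (\<lambda>x y. G x y a))"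
    unfolding metric_tsum FG by (rule Q_antipode_antipode) (intro G_lin)
  also have "\<dots> = tsum Q (\<lambda>a b. tsum Q (\<lambda>c d. G b d (a * c)))"
    by (rule Q_braided_coproduct) (intro G_lin)
  also have "\<dots> = tsum Q (\<lambda>a b. tsum Q (\<lambda>c d. G d b (c * a)))"
    by (rule tsum_swap)
  also have "\<dots> = tsum Q (\<lambda>a b. tsum Q (\<lambda>c d. G d (S a) (c * S b)))"
    by (rule Q_antipode_antipode[symmetric]) (intro G_lin)
  also have "\<dots> = tsum Q (\<lambda>a b. tsum Q (\<lambda>c d. G (S c) (S a) (S d * S b)))"
    by (intro tsum_cong Q_antipode_antipode[symmetric]) (intro G_lin)
  also have "\<dots> = tsum Theta (\<lambda>a b. tsum Theta (\<lambda>c d. F c a (b * d)))"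
    by (simp add: metric_tsum FG antipode_mult)
  finally show ?thesis .
qed

text \<open>The inverse identities are stated against an arbitrary functional, since later proofs
  use them to insert a copy of \<Theta> into a linear expression or to contract it.\<close>

lemma exists_inverse_form:
  "\<exists>\<theta>. bilin \<theta> \<and>
    (\<forall>f x. functional f \<longrightarrow> tsum Theta (\<lambda>a b. \<theta> x a * f b) = f x) \<and>
    (\<forall>f y. functional f \<longrightarrow> tsum Theta (\<lambda>a b. f a * \<theta> b y) = f y)"
proof -
  define \<Phi> where "\<Phi> f = tsum Q (\<lambda>a b. scale (f a) b)" for f
  define G where "G x = (THE f. functional f \<and> \<Phi> f = x)" for x
  have G: "functional (G x)" "\<Phi> (G x) = x" for x
    using theI'[OF factorisable_ex1[of x]] by (simp_all add: G_def \<Phi>_def)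
  have G_eq: "G x = f" if "functional f" "\<Phi> f = x" for f x
    unfolding G_def using factorisable_ex1[of x] that by (intro the1_equality) (simp_all add: \<Phi>_def)
  note lin = multilinear_intros endo_antipode_inv functional_comp[OF G(1)]
  \<comment> \<open>\<open>G\<close> inverts the map given by \<open>Q\<close>; the inverse antipode
    cancels the \<open>S\<close> in the first leg of \<Theta>.\<close>
  define \<theta> where "\<theta> x y = G x (inv S y)" for x y
  \<comment> \<open>\<open>G\<close> is chosen separately for each \<open>x\<close>, so linearity in
    \<open>x\<close> has to come from uniqueness of the preimage.\<close>
  have "functional (\<lambda>x. G x y)" for y
  proof (rule functionalI)
    show "G (x + x') y = G x y + G x' y" for x x'
    proof -
      have "functional (\<lambda>y. G x y + G x' y)"
        using G(1) by (simp add: functional_iff algebra_simps)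
      moreover have "\<Phi> (\<lambda>y. G x y + G x' y) = \<Phi> (G x) + \<Phi> (G x')"
        by (simp add: \<Phi>_def tsum_add scale_left_distrib)
      ultimately have "G (x + x') = (\<lambda>y. G x y + G x' y)"
        using G(2) by (intro G_eq) simp_all
      then show ?thesis
        by simp
    qed
    show "G (scale c x) y = c * G x y" for c x
    proof -
      have "\<Phi> (\<lambda>y. c * G x y) = scale c (\<Phi> (G x))"
        by (simp add: \<Phi>_def tsum_scale_right)
      then have "G (scale c x) = (\<lambda>y. c * G x y)"
        using G by (intro G_eq functional_mult) simp_all
      then show ?thesis
        by simp
    qed
  qed
  then have \<theta>: "bilin \<theta>"
    unfolding \<theta>_def by (intro lin)
  show ?thesis
  proof (intro exI conjI allI impI)
    show "bilin \<theta>"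
      by (rule \<theta>)
    show "tsum Theta (\<lambda>a b. \<theta> x a * f b) = f x" if f: "functional f" for f x
      using functional_apply_tsum[OF f, of Q "\<lambda>a b. scale (G x a) b"] G(2)[of x]
      by (simp add: metric_tsum \<theta>_def antipode_inv functionalD[OF f] \<Phi>_def)
    show "tsum Theta (\<lambda>a b. f a * \<theta> b y) = f y" if f: "functional f" for f y
    proof -
      have fS: "functional (\<lambda>a. f (S a))"
        by (intro lin functional_comp[OF f])
      have "f y = \<theta> (\<Phi> (\<lambda>a. f (S a))) y"
        by (simp add: \<theta>_def G_eq[OF fS HOL.refl] antipode_inv)
      also have "\<dots> = tsum Q (\<lambda>a b. f (S a) * \<theta> b y)"
        using functional_apply_tsum[of "\<lambda>x. \<theta> x y" Q "\<lambda>a b. scale (f (S a)) b"]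
          functionalD(2)[of "\<lambda>x. \<theta> x y"] \<theta>
        by (simp add: \<Phi>_def bilin_def)
      finally show ?thesis
        by (simp add: metric_tsum)
    qed
  qed
qed

end

section \<open>Transfer of the properties of \<Theta> to the inverse form\<close>

theorem proposition4p6:
  fixes scale :: "'k::field \<Rightarrow> 'h::ring_1 \<Rightarrow> 'h"
    and \<Delta> :: "'h \<Rightarrow> ('h \<times> 'h) list"
    and \<epsilon> :: "'h \<Rightarrow> 'k"
    and S :: "'h \<Rightarrow> 'h"
    and R :: "('h \<times> 'h) list"
  assumes "fd_factorisable_hopf_algebra scale \<Delta> \<epsilon> S R"
  shows "\<exists>\<theta> :: 'h \<Rightarrow> 'h \<Rightarrow> 'k.
    type2_hadamard_form \<Delta> \<epsilon> (transmutation scale \<Delta> \<epsilon> S R) \<theta> \<and>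
    inverse_metric \<Delta> \<epsilon> (transmutation scale \<Delta> \<epsilon> S R) \<theta> (metric_element S R)"
proof -
  interpret fd_factorisable_hopf_algebra scale \<Delta> \<epsilon> S R
    by fact
  obtain \<theta> where \<theta>: "bilin \<theta>"
    and \<theta>_left: "\<And>f x. functional f \<Longrightarrow> tsum Theta (\<lambda>a b. \<theta> x a * f b) = f x"
    and \<theta>_right: "\<And>f y. functional f \<Longrightarrow> tsum Theta (\<lambda>a b. f a * \<theta> b y) = f y"
    using exists_inverse_form by (elim exE conjE) simp
  note lin = multilinear_intros bilin_comp[OF \<theta>] endo_ad functional_braided_coproduct
  let ?B = "transmutation scale \<Delta> \<epsilon> S R"
  have B [simp]: "bscale ?B = scale" "baction ?B = ad" "bmult ?B = (*)" "bunit ?B = 1"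
      "bcounit ?B = \<epsilon>"
    by (simp_all add: transmutation_def)
  \<comment> \<open>Insert a copy of \<Theta> between \<open>x\<close> and \<open>ad h\<close>, move
    the action to the other leg and contract again.\<close>
  have transpose: "\<theta> (ad h x) y = \<theta> x (ad (S h) y)" for h x y
  proof -
    have "\<theta> (ad h x) y = tsum Theta (\<lambda>a b. \<theta> x a * \<theta> (ad h b) y)"
      by (rule \<theta>_left[symmetric]) (intro lin)
    also have "\<dots> = tsum Theta (\<lambda>a b. \<theta> x (ad (S h) a) * \<theta> b y)"
      by (rule metric_ad_transpose) (intro lin)
    also have "\<dots> = \<theta> x (ad (S h) y)"
      by (rule \<theta>_right) (intro lin)
    finally show ?thesis .
  qed
  \<comment> \<open>Transposing the first action leaves \<open>ad (S h1 * h2)\<close> on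
    \<open>y\<close>, which the antipode axiom reduces to a counit.\<close>
  have "tsum (\<Delta> h) (\<lambda>h1 h2. \<theta> (ad h1 x) (ad h2 y)) = \<epsilon> h * \<theta> x y" for h x y
    using antipode_tsum(1)[of "\<lambda>z. \<theta> x (ad z y)" h] by (simp add: transpose ad_mult ad_one lin)
  then have morphism: "form_morphism \<Delta> \<epsilon> ?B \<theta>"
    using \<theta> by (simp add: form_morphism_def bilinear_form_def bilin_def functional_def tsum_def)
  have "tensor2_eq scale [(ad h1 a, ad h2 b). (h1, h2) \<leftarrow> \<Delta> h, (a, b) \<leftarrow> Theta]
      (tensor2_scale scale (\<epsilon> h) Theta)" for h
  proof (rule tensor2_eqI)
    fix F assume F: "bilin F"
    have "tsum [(ad h1 a, ad h2 b). (h1, h2) \<leftarrow> \<Delta> h, (a, b) \<leftarrow> Theta] F =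
        tsum (\<Delta> h) (\<lambda>h1 h2. tsum Theta (\<lambda>a b. F (ad h1 a) (ad h2 b)))"
      by (simp add: tsum_concat_map tsum_map case_prod_unfold) (simp add: tsum_def case_prod_unfold)
    then show "tsum [(ad h1 a, ad h2 b). (h1, h2) \<leftarrow> \<Delta> h, (a, b) \<leftarrow> Theta] F =
        tsum (tensor2_scale scale (\<epsilon> h) Theta) F"
      by (simp add: metric_invariant_tsum[OF F] tsum_tensor2_scale[OF F])
  qed
  moreover have "tsum Theta (\<lambda>a b. scale (\<theta> x a) b) = x" for x
    by (rule functional_ext) (simp add: functional_apply_tsum functionalD \<theta>_left)
  moreover have "tsum Theta (\<lambda>a b. scale (\<theta> b x) a) = x" for x
    by (rule functional_ext) (simp add: functional_apply_tsum functionalD \<theta>_right mult.commute)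
  ultimately have inverse: "inverse_metric \<Delta> \<epsilon> ?B \<theta> Theta"
    by (simp add: inverse_metric_def metric_morphism_def tsum_def)
  \<comment> \<open>The right side is linear in \<open>z\<close>, so \<open>z\<close> can be
    replaced by the first leg of \<Theta>. There the braided coproduct becomes a product in the
    second leg, and two contractions give the left side.\<close>
  have "\<theta> (x * y) z = tsum (braided_coproduct z) (\<lambda>z1 z2. \<theta> x z2 * \<theta> y z1)" for x y z
  proof -
    have "tsum (braided_coproduct z) (\<lambda>z1 z2. \<theta> x z2 * \<theta> y z1) =
        tsum Theta (\<lambda>a b. tsum (braided_coproduct a) (\<lambda>z1 z2. \<theta> x z2 * \<theta> y z1) * \<theta> b z)"
      by (rule \<theta>_right[symmetric]) (intro lin)
    also have "\<dots> = tsum Theta (\<lambda>a b. tsum Theta (\<lambda>c d. \<theta> x a * \<theta> y c * \<theta> (b * d) z))"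
      unfolding tsum_distrib_right by (rule metric_coproduct_left) (intro lin)
    also have "\<dots> = \<theta> (x * y) z"
      using \<theta>_left[of "\<lambda>u. \<theta> (b * u) z" y for b] \<theta>_left[of "\<lambda>u. \<theta> (u * y) z" x]
      by (simp add: mult.assoc tsum_distrib_left[symmetric] lin)
    finally show ?thesis by simp
  qed
  \<comment> \<open>The mirror argument: \<Theta> is inserted on the other side, and the braided
    coproduct falls on its second leg.\<close>
  moreover have "\<theta> x (y * z) = tsum (braided_coproduct x) (\<lambda>x1 x2. \<theta> x2 y * \<theta> x1 z)" for x y z
  proof -
    have "tsum (braided_coproduct x) (\<lambda>x1 x2. \<theta> x2 y * \<theta> x1 z) =
        tsum Theta (\<lambda>a b. \<theta> x a * tsum (braided_coproduct b) (\<lambda>x1 x2. \<theta> x2 y * \<theta> x1 z))"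
      by (rule \<theta>_left[symmetric]) (intro lin)
    also have "\<dots> = tsum Theta (\<lambda>a b. tsum Theta (\<lambda>c d. \<theta> x (a * c) * (\<theta> b y * \<theta> d z)))"
      unfolding tsum_distrib_left by (rule metric_coproduct_right) (intro lin)
    also have "\<dots> = tsum Theta (\<lambda>a b. tsum Theta (\<lambda>c d. \<theta> x (a * c) * \<theta> d z) * \<theta> b y)"
      unfolding tsum_distrib_right by (intro tsum_cong) (simp add: ac_simps)
    also have "\<dots> = \<theta> x (y * z)"
      using \<theta>_right[of "\<lambda>u. \<theta> x (a * u)" z for a] \<theta>_right[of "\<lambda>u. \<theta> x (u * z)" y]
      by (simp add: lin)
    finally show ?thesis by simp
  qed
  \<comment> \<open>Expand the counit through \<Theta>; it absorbs the antipode and reduces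
    \<open>Q\<close> to 1.\<close>
  moreover have "\<theta> 1 x = \<epsilon> x" for x
  proof -
    have "\<epsilon> x = tsum Theta (\<lambda>a b. \<epsilon> a * \<theta> b x)"
      by (rule \<theta>_right[symmetric]) (intro lin)
    also have "\<dots> = tsum Q (\<lambda>a b. \<epsilon> a * \<theta> b x)"
      by (simp add: metric_tsum counit_antipode)
    also have "\<dots> = \<theta> 1 x"
      by (rule Q_counit) (intro lin)
    finally show ?thesis by simp
  qed
  \<comment> \<open>Here the counit meets the second leg, so the antipode survives and ends up on
    1.\<close>
  moreover have "\<theta> x 1 = \<epsilon> x" for x
  proof -
    have "\<epsilon> x = tsum Theta (\<lambda>a b. \<theta> x a * \<epsilon> b)"
      by (rule \<theta>_left[symmetric]) (intro lin)
    also have "\<dots> = \<theta> x (S 1)"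
      using Q_counit(2)[of "\<lambda>a. \<theta> x (S a)"] by (simp add: metric_tsum lin mult.commute)
    finally show ?thesis by (simp add: antipode_one)
  qed
  ultimately have "type2_hadamard_form \<Delta> \<epsilon> ?B \<theta>"
    using morphism inverse by (auto simp: type2_hadamard_form_def tsum_def)
  with inverse show ?thesis
    by blast
qed

end
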